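(* Let $q \in \{2,3\}$, let $\sigma_2 = 2$ and $\sigma_3 = C_0$ (the constant described in the context). For any integers $t \geq s \geq 2$, \[R_q(s,t) \leq \tau_s(2t),\] where $\tau_1(x) = x$ and $\tau_{j+1}(x) = \sigma_q^{\tau_j(x)}$ for $j \geq 1$ (i.e., $\tau_s(2t)$ is a tower $\sigma_q^{\sigma_q^{\cdot^{\cdot^{\sigma_q^{2t}}}}}$ of height $s$, counting the top entry $2t$ as one level).
   Context: For a finite field $\mathbb F_q$ and positive integers $s,t$, $R_q(s,t)$ denotes the minimum $n$ such that for every red-blue coloring of the $1$-dimensional linear subspaces of $\mathbb F_q^n$, there is either a linear subspace of dimension $s$ all of whose $1$-dimensional subspaces are red, or a linear subspace of dimension $t$ all of whose $1$-dimensional subspaces are blue. The constant $C_0 \approx 13.901$ is the absolute constant $C_0 = 1 + 1/(1-\log_3 \gamma)$ with $\gamma = \min_{0<x<1}(1+x+x^2)/x^{2/3} \approx 2.7552$ (the constant of Fox–Pham's theorem); it has the known property that every $A \subseteq \mathbb F_3^n$ with $|A| = \alpha 3^n$ contains at least $\alpha^{C_0} 3^{2n}$ triples of the form $(x, x+d, x+2d)$ with $x,d \in \mathbb F_3^n$. *)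

theory Defs
  imports Complex_Main "HOL-Library.Function_Algebras"
begin

(* Vectors of F^n, with F a (finite) field: functions nat => F vanishing from index n on. *)
definition vscale :: "'a::field \<Rightarrow> (nat \<Rightarrow> 'a) \<Rightarrow> (nat \<Rightarrow> 'a)" where
  "vscale c v = (\<lambda>i. c * v i)"

lemma vscale_vector_space: "vector_space (vscale :: 'a::field \<Rightarrow> _)"
  by unfold_locales (auto simp: vscale_def fun_eq_iff algebra_simps)

definition Fn :: "nat \<Rightarrow> (nat \<Rightarrow> 'a::zero) set" where
  "Fn n = {v. \<forall>i\<ge>n. v i = 0}"

definition lin_subspaces :: "'a::field itself \<Rightarrow> nat \<Rightarrow> nat \<Rightarrow> (nat \<Rightarrow> 'a) set set" where
  "lin_subspaces _ n d = {W. W \<subseteq> Fn n \<and> module.subspace (vscale :: 'a \<Rightarrow> _) W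
                              \<and> vector_space.dim (vscale :: 'a \<Rightarrow> _) W = d}"

definition ramsey_prop :: "'a::field itself \<Rightarrow> nat \<Rightarrow> nat \<Rightarrow> nat \<Rightarrow> bool" where
  "ramsey_prop F n s t \<longleftrightarrow>
     (\<forall>col :: (nat \<Rightarrow> 'a) set \<Rightarrow> bool.
        (\<exists>W\<in>lin_subspaces F n s. \<forall>L\<in>lin_subspaces F n 1. L \<subseteq> W \<longrightarrow> col L)
      \<or> (\<exists>W\<in>lin_subspaces F n t. \<forall>L\<in>lin_subspaces F n 1. L \<subseteq> W \<longrightarrow> \<not> col L))"

definition ramsey_num :: "'a::field itself \<Rightarrow> nat \<Rightarrow> nat \<Rightarrow> nat" where
  "ramsey_num F s t = (LEAST n. ramsey_prop F n s t)"

definition gamma0 :: real where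
  "gamma0 = Inf ((\<lambda>x. (1 + x + x\<^sup>2) / x powr (2/3)) ` {0<..<1})"

definition C0 :: real where
  "C0 = 1 + 1 / (1 - log 3 gamma0)"

fun tower :: "real \<Rightarrow> nat \<Rightarrow> real \<Rightarrow> real" where
  "tower \<sigma> 0 x = x"
| "tower \<sigma> (Suc 0) x = x"
| "tower \<sigma> (Suc (Suc j)) x = \<sigma> powr tower \<sigma> (Suc j) x"

end

(*
  If no t-dimensional subspace of V is blue, the red vectors have density at least q^-t (extend a
  maximal blue subspace). Since the density of lines in a set of density a is at least about a^C,
  iterating over k independent directions yields a red affine subspace x + U with dim U = k as soon
  as dim V is about t C^k. Applying the result for (s - 1, t) inside U gives a red
  (s - 1)-dimensional subspace W of U, and then W together with x spans a red subspace of
  dimension s. This gives the tower recursion N(s) = (t + e) C^N(s-1) + N(s-1).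

  For q = 2, C = 2 is Cauchy-Schwarz. For q = 3 the slack in the tower bound (its top is 2t, while
  the recursion starts at t) allows the cruder exponent C = 16 in place of C0, which is only needed
  to be at least 8. It comes from the slice rank bound on cap sets, applied to the preimage of the
  set under a random affine map from a space of suitable dimension.
*)
theory Submission
  imports Defs "HOL-Library.FuncSet"
begin

section \<open>Linear systems over a finite field\<close>

text \<open>The directions chosen in the iteration must be independent, while an average over all
  directions also counts those in the span already built. Their total share is below
  \<open>q ^ k / card V\<close>, and the summand \<open>+ k\<close> in the recursion pays for it. A
  constant factor lost in the line count would be lost at every iteration; multiplying densities by
  \<open>1 / q ^ e\<close> makes the inequality constant-free, at the price of \<open>t + e\<close>
  in place of \<open>t\<close>. The exponent 16 is 15 + 1: in dimension \<open>15 * i\<close> the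
  slice rank bounds the relative density of a cap set by \<open>3 * 3 ^ -i\<close>, so for density
  \<alpha> one takes \<open>3 ^ i\<close> of order 1/\<alpha>, and the line density is then at least
  of order \<alpha> * \<open>3 ^ (-15 * i)\<close>. The number 8 enters because 16 = 8 powr (4/3):
  the invariant \<open>4 * N + 2 * t <= 3 * T\<close> between a dimension N and a tower T of base at
  least 8 survives each level, and it is an equality at the bottom, where N = t and T = 2t.\<close>

text \<open>Pigeonhole instead of rank: there are more assignments on \<open>A\<close> than possible
  values of the system, so two assignments agree on it, and their difference is the
  solution.\<close>

lemma exists_nonzero_solution:
  fixes g :: "'i \<Rightarrow> 'b \<Rightarrow> 'a::{field,finite}"
  assumes "finite A" "finite I" "card I < card A"
  shows "\<exists>w. (\<exists>a\<in>A. w a \<noteq> 0) \<and> (\<forall>i\<in>I. (\<Sum>a\<in>A. g i a * w a) = 0)"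
proof -
  define \<Phi> where "\<Phi> w = restrict (\<lambda>i. \<Sum>a\<in>A. g i a * w a) I" for w
  have "1 < card (UNIV :: 'a set)"
    using card_mono[of "UNIV :: 'a set" "{0,1}"] by simp
  then have "card (I \<rightarrow>\<^sub>E (UNIV :: 'a set)) < card (A \<rightarrow>\<^sub>E (UNIV :: 'a set))"
    using assms by (simp add: card_PiE)
  moreover have "\<Phi> ` (A \<rightarrow>\<^sub>E UNIV) \<subseteq> I \<rightarrow>\<^sub>E UNIV"
    by (auto simp: \<Phi>_def)
  ultimately have "\<not> inj_on \<Phi> (A \<rightarrow>\<^sub>E UNIV)"
    using card_inj_on_le[of \<Phi> "A \<rightarrow>\<^sub>E UNIV" "I \<rightarrow>\<^sub>E UNIV"] assms
    by (auto simp: finite_PiE)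
  then obtain w1 w2 where w: "w1 \<in> A \<rightarrow>\<^sub>E UNIV" "w2 \<in> A \<rightarrow>\<^sub>E UNIV" "\<Phi> w1 = \<Phi> w2" "w1 \<noteq> w2"
    by (auto simp: inj_on_def)
  have "\<exists>a\<in>A. w1 a \<noteq> w2 a"
    using w PiE_ext by blast
  moreover have "(\<Sum>a\<in>A. g i a * (w1 a - w2 a)) = 0" if "i \<in> I" for i
    using fun_cong[OF w(3), of i] that by (simp add: \<Phi>_def right_diff_distrib sum_subtractf)
  ultimately show ?thesis
    by (intro exI[of _ "\<lambda>a. w1 a - w2 a"]) auto
qed

text \<open>Take a solution \<open>h\<close> of maximal support. If the support were too small, one
  could also require \<open>w\<close> to vanish on it and still find a nonzero solution
  \<open>w\<close>; then \<open>h + w\<close> would have larger support.\<close>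

lemma exists_solution_large_support:
  fixes g :: "'i \<Rightarrow> 'b \<Rightarrow> 'a::{field,finite}"
  assumes "finite A" "finite I"
  shows "\<exists>h. (\<forall>i\<in>I. (\<Sum>a\<in>A. g i a * h a) = 0) \<and> card A \<le> card I + card {a\<in>A. h a \<noteq> 0}"
proof -
  define P where "P h \<longleftrightarrow> (\<forall>i\<in>I. (\<Sum>a\<in>A. g i a * h a) = 0)" for h
  define supp where "supp h = {a\<in>A. h a \<noteq> 0}" for h :: "'b \<Rightarrow> 'a"
  have "P (\<lambda>_. 0)" by (simp add: P_def)
  moreover have "\<forall>h. P h \<longrightarrow> card (supp h) < Suc (card A)"
    using assms by (auto simp: supp_def less_Suc_eq_le intro!: card_mono)
  ultimately obtain h where h: "P h" "\<And>h'. P h' \<Longrightarrow> card (supp h') \<le> card (supp h)"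
    using ex_has_greatest_nat[of P "\<lambda>_. 0" "\<lambda>h. card (supp h)"] by blast
  have "card A \<le> card I + card (supp h)"
  proof (rule ccontr)
    assume "\<not> ?thesis"
    then have less: "card (I <+> supp h) < card A"
      using assms by (simp add: card_Plus supp_def)
    \<comment> \<open>Index \<open>Inl i\<close> carries an equation of the system, index
      \<open>Inr b\<close> the equation \<open>w b = 0\<close>.\<close>
    obtain w where w: "\<exists>a\<in>A. w a \<noteq> 0"
      "\<forall>i\<in>I <+> supp h. (\<Sum>a\<in>A. case_sum g (\<lambda>b a. if b = a then 1 else 0) i a * w a) = 0"
      using exists_nonzero_solution[OF assms(1) _ less,
          of "case_sum g (\<lambda>b a. if b = a then 1 else 0)"] assms
      by (auto simp: supp_def simp del: Plus_def)
    have w0: "w b = 0" if "b \<in> supp h" for b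
    proof -
      have "(\<Sum>a\<in>A. (if b = a then 1 else 0) * w a) = 0"
        using w(2)[rule_format, of "Inr b"] that by auto
      moreover have "(\<Sum>a\<in>A. (if b = a then 1 else 0) * w a) = (\<Sum>a\<in>A. if b = a then w a else 0)"
        by (intro sum.cong) auto
      ultimately show ?thesis using assms(1) that by (simp add: sum.delta' supp_def)
    qed
    have wI: "(\<Sum>a\<in>A. g i a * w a) = 0" if "i \<in> I" for i
      using w(2)[rule_format, of "Inl i"] that by auto
    have "P (\<lambda>a. h a + w a)"
      using h(1) wI by (simp add: P_def distrib_left sum.distrib)
    moreover have "supp h \<subset> supp (\<lambda>a. h a + w a)"
    proof -
      obtain a where a: "a \<in> A" "w a \<noteq> 0" using w(1) by blast
      then have "a \<notin> supp h" using w0 by auto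
      moreover have "a \<in> supp (\<lambda>a. h a + w a)" using a calculation by (auto simp: supp_def)
      moreover have "supp h \<subseteq> supp (\<lambda>a. h a + w a)" using w0 by (auto simp: supp_def)
      ultimately show ?thesis by blast
    qed
    then have "card (supp h) < card (supp (\<lambda>a. h a + w a))"
      using assms(1) by (intro psubset_card_mono) (auto simp: supp_def)
    ultimately show False using h(2) by fastforce
  qed
  then show ?thesis using h(1) unfolding P_def supp_def by blast
qed

text \<open>A sum of \<open>card K\<close> matrices of rank one cannot equal an invertible diagonal
  matrix of larger size: some nonzero \<open>w\<close> is killed by every \<open>v k\<close>, but
  not by the diagonal.\<close>

lemma card_le_diagonal_rank:
  fixes d :: "'b \<Rightarrow> 'a::{field,finite}"
  assumes "finite S" "finite K" "\<And>y. y \<in> S \<Longrightarrow> d y \<noteq> 0"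
    and eq: "\<And>y z. y \<in> S \<Longrightarrow> z \<in> S \<Longrightarrow> (\<Sum>k\<in>K. u k y * v k z) = (if y = z then d y else 0)"
  shows "card S \<le> card K"
proof (rule ccontr)
  assume "\<not> ?thesis"
  then obtain w where w: "\<exists>a\<in>S. w a \<noteq> 0" "\<And>k. k \<in> K \<Longrightarrow> (\<Sum>z\<in>S. v k z * w z) = 0"
    using exists_nonzero_solution[OF assms(1,2), of v] by auto
  then obtain y where y: "y \<in> S" "w y \<noteq> 0" by blast
  have "0 = (\<Sum>k\<in>K. u k y * (\<Sum>z\<in>S. v k z * w z))"
    using w by simp
  also have "\<dots> = (\<Sum>k\<in>K. \<Sum>z\<in>S. u k y * v k z * w z)"
    by (simp add: sum_distrib_left mult.assoc)
  also have "\<dots> = (\<Sum>z\<in>S. (\<Sum>k\<in>K. u k y * v k z) * w z)"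
    by (subst sum.swap) (simp add: sum_distrib_right)
  also have "\<dots> = (\<Sum>z\<in>S. if y = z then d y * w z else 0)"
    using eq y by (intro sum.cong) auto
  also have "\<dots> = d y * w y"
    using y assms by simp
  finally show False using y assms(3) by simp
qed

section \<open>Cap sets\<close>

text \<open>Exponent vectors of the monomials in m variables with degree at most 2 in each variable
  and total degree at most 2m/3, one third of the degree of the slice rank polynomial.\<close>

definition cap_exponents :: "nat \<Rightarrow> (nat \<Rightarrow> nat) set" where
  "cap_exponents m = {e \<in> {..<m} \<rightarrow>\<^sub>E {..2}. 3 * (\<Sum>i<m. e i) \<le> 2 * m}"

text \<open>Exponents (p, q, r) of the monomials \<open>a ^ p * b ^ q * c ^ r\<close> in
  \<open>1 - (a + b + c) ^ 2\<close>.\<close>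

definition slice_triples :: "(nat \<times> nat \<times> nat) set" where
  "slice_triples = {(0,0,0),(2,0,0),(0,2,0),(0,0,2),(1,1,0),(1,0,1),(0,1,1)}"

lemma finite_cap_exponents: "finite (cap_exponents m)"
  unfolding cap_exponents_def by (rule finite_subset[of _ "{..<m} \<rightarrow>\<^sub>E {..2}"]) (auto intro: finite_PiE)

text \<open>Over a field with three elements, \<open>1 - (a + b + c)^2\<close> is the indicator of \<open>a + b + c = 0\<close>,
  and \<open>x + y + z = 0\<close> means that \<open>x\<close>, \<open>y\<close>, \<open>z\<close> are equal or form a line.\<close>

lemma slice_expansion:
  fixes a b c :: "'a::field"
  shows "1 - (a + b + c)^2 = (\<Sum>(p,q,r)\<in>slice_triples.
     (if p + q + r = 0 then 1 else if p = 1 \<or> q = 1 then -2 else -1) * (a ^ p * (b ^ q * c ^ r)))"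
  by (simp add: slice_triples_def power2_eq_square algebra_simps)

lemma card_3_field:
  assumes "card (UNIV :: 'a::{field,finite} set) = 3"
  shows "(1::'a) + 1 + 1 = 0" and "\<And>c::'a. c = 0 \<or> c = 1 \<or> c = -1"
proof -
  have "card (UNIV - {0, 1::'a}) = 1"
    using assms by (subst card_Diff_subset) auto
  then obtain a where a: "UNIV - {0, 1::'a} = {a}"
    by (rule card_1_singletonE)
  then have a01: "a \<noteq> 0" "a \<noteq> 1" and all: "\<And>c::'a. c = 0 \<or> c = 1 \<or> c = a" by auto
  have "(1::'a) + 1 \<noteq> 0"
  proof
    assume two: "(1::'a) + 1 = 0"
    have "a + 1 = 0" using all[of "a + 1"] a01 by auto
    then show False using two a01 by (metis add_right_cancel)
  qed
  then have "1 + 1 = a" using all[of "1 + 1"] by (metis add_cancel_left_right zero_neq_one)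
  moreover have "a + 1 = 0" using all[of "a + 1"] a01 by auto
  moreover from this have "a = -1" by (simp add: eq_neg_iff_add_eq_0)
  ultimately show "(1::'a) + 1 + 1 = 0" and "\<And>c::'a. c = 0 \<or> c = 1 \<or> c = -1"
    using all by auto
qed

text \<open>The slice rank argument. On B the polynomial \<open>T\<close> is the diagonal tensor,
  and each of its monomials has low degree in x, y or z. Contracting the x variable with a function
  \<open>h\<close> orthogonal to all low-degree monomials leaves a diagonal matrix of rank at most
  twice the number of these monomials, while \<open>h\<close> is nonzero on all but at most that
  many points of B.\<close>

lemma cap_set_card_le:
  fixes B :: "(nat \<Rightarrow> 'a::{field,finite}) set"
  assumes card3: "card (UNIV :: 'a set) = 3"
    and fin: "finite B" and sub: "B \<subseteq> Fn m"
    and cap: "\<And>y d. d \<noteq> 0 \<Longrightarrow> \<exists>c. y + vscale c d \<notin> B"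
  shows "card B \<le> 3 * card (cap_exponents m)"
proof -
  define E where "E = cap_exponents m"
  have finE: "finite E" by (simp add: E_def finite_cap_exponents)
  define mon :: "(nat \<Rightarrow> nat) \<Rightarrow> (nat \<Rightarrow> 'a) \<Rightarrow> 'a" where "mon e x = (\<Prod>i<m. x i ^ e i)" for e x
  define T :: "(nat \<Rightarrow> 'a) \<Rightarrow> (nat \<Rightarrow> 'a) \<Rightarrow> (nat \<Rightarrow> 'a) \<Rightarrow> 'a"
    where "T x y z = (\<Prod>i<m. 1 - (x i + y i + z i)^2)" for x y z
  define \<Omega> where "\<Omega> = {..<m} \<rightarrow>\<^sub>E slice_triples"
  have fin\<Omega>: "finite \<Omega>" by (simp add: \<Omega>_def slice_triples_def finite_PiE)
  define co :: "nat \<times> nat \<times> nat \<Rightarrow> 'a" where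
    "co = (\<lambda>(p,q,r). if p + q + r = 0 then 1 else if p = 1 \<or> q = 1 then -2 else -1)"
  define cf where "cf s = (\<Prod>i<m. co (s i))" for s :: "nat \<Rightarrow> nat \<times> nat \<times> nat"
  define p1 where "p1 s = restrict (\<lambda>i. fst (s i)) {..<m}" for s :: "nat \<Rightarrow> nat \<times> nat \<times> nat"
  define p2 where "p2 s = restrict (\<lambda>i. fst (snd (s i))) {..<m}" for s :: "nat \<Rightarrow> nat \<times> nat \<times> nat"
  define p3 where "p3 s = restrict (\<lambda>i. snd (snd (s i))) {..<m}" for s :: "nat \<Rightarrow> nat \<times> nat \<times> nat"
  have T_expand: "T x y z = (\<Sum>s\<in>\<Omega>. cf s * (mon (p1 s) x * (mon (p2 s) y * mon (p3 s) z)))" for x y z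
  proof -
    have "T x y z = (\<Prod>i<m. \<Sum>s\<in>slice_triples. co s * (x i ^ fst s * (y i ^ fst (snd s) * z i ^ snd (snd s))))"
      unfolding T_def slice_expansion by (intro prod.cong refl sum.cong) (auto simp: co_def)
    also have "\<dots> = (\<Sum>s\<in>\<Omega>. \<Prod>i<m. co (s i) * (x i ^ fst (s i) * (y i ^ fst (snd (s i)) * z i ^ snd (snd (s i)))))"
      unfolding \<Omega>_def by (rule prod_sum_PiE) (auto simp: slice_triples_def)
    also have "\<dots> = (\<Sum>s\<in>\<Omega>. cf s * (mon (p1 s) x * (mon (p2 s) y * mon (p3 s) z)))"
      by (simp add: prod.distrib cf_def mon_def p1_def p2_def p3_def)
    finally show ?thesis .
  qed
  \<comment> \<open>The three degrees add up to at most 2m, so the smallest is at most 2m/3.\<close>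
  have pE: "p1 s \<in> E \<or> p2 s \<in> E \<or> p3 s \<in> E" if s: "s \<in> \<Omega>" for s
  proof -
    have si: "fst (s i) + fst (snd (s i)) + snd (snd (s i)) \<le> 2" if "i < m" for i
      using s that by (auto simp: \<Omega>_def slice_triples_def dest!: PiE_mem[of _ _ _ i])
    have r: "p1 s \<in> {..<m} \<rightarrow>\<^sub>E {..2}" "p2 s \<in> {..<m} \<rightarrow>\<^sub>E {..2}" "p3 s \<in> {..<m} \<rightarrow>\<^sub>E {..2}"
      using si by (auto simp: p1_def p2_def p3_def) (use le_trans in fastforce)+
    have "(\<Sum>i<m. p1 s i) + (\<Sum>i<m. p2 s i) + (\<Sum>i<m. p3 s i) = (\<Sum>i<m. fst (s i) + fst (snd (s i)) + snd (snd (s i)))"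
      by (simp add: p1_def p2_def p3_def sum.distrib)
    also have "\<dots> \<le> (\<Sum>i<m. 2)" by (intro sum_mono) (use si in auto)
    finally have "3 * sum (p1 s) {..<m} \<le> 2 * m \<or> 3 * sum (p2 s) {..<m} \<le> 2 * m \<or> 3 * sum (p3 s) {..<m} \<le> 2 * m"
      by simp linarith
    then show ?thesis using r unfolding E_def cap_exponents_def by blast
  qed
  have T_diag: "T x y z = (if x = y \<and> y = z then 1 else 0)" if xyz: "x \<in> B" "y \<in> B" "z \<in> B" for x y z
  proof (cases "\<forall>i<m. x i + y i + z i = 0")
    case True
    have s0: "x i + y i + z i = 0" for i
    proof (cases "i < m")
      case False
      then have "x i = 0" "y i = 0" "z i = 0" using xyz sub by (auto simp: Fn_def)
      then show ?thesis by simp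
    qed (use True in auto)
    have x3: "x i + x i + x i = 0" for i
      using card_3_field(1)[OF card3] by (metis distrib_right mult_1 mult_zero_left)
    have "x = y"
    proof (rule ccontr)
      assume "x \<noteq> y"
      then have "y - x \<noteq> 0" by simp
      then obtain c where c: "x + vscale c (y - x) \<notin> B" using cap by blast
      \<comment> \<open>In characteristic 3, x + y + z = 0 says z = 2x - y, so x, y, z are the
        points with parameters 0, 1, -1 of one line, and these are all the parameters there
        are.\<close>
      have "x + vscale (-1) (y - x) = z"
      proof
        fix i
        have "x i + (-1) * (y i - x i) = z i + (x i + x i + x i) - (x i + y i + z i)"
          by (simp add: algebra_simps)
        then show "(x + vscale (-1) (y - x)) i = z i"
          using s0[of i] x3[of i] by (simp add: vscale_def)
      qed
      moreover have "x + vscale 0 (y - x) = x" "x + vscale 1 (y - x) = y"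
        by (auto simp: vscale_def fun_eq_iff)
      ultimately show False using c xyz card_3_field(2)[OF card3, of c] by auto
    qed
    moreover have "y = z"
    proof
      fix i
      have "y i - z i = (x i + x i + x i) - (x i + y i + z i) + 2 * (y i - x i)"
        by (simp add: algebra_simps)
      then have "y i - z i = 2 * (y i - x i)"
        by (simp only: s0 x3 diff_self add_0)
      then show "y i = z i" using \<open>x = y\<close> by simp
    qed
    moreover have "T x y z = 1" unfolding T_def using True by (intro prod.neutral) auto
    ultimately show ?thesis by simp
  next
    case False
    then obtain i where i: "i < m" "x i + y i + z i \<noteq> 0" by blast
    then have "1 - (x i + y i + z i)^2 = 0"
      using card_3_field(2)[OF card3, of "x i + y i + z i"] by auto
    then have "T x y z = 0" using i unfolding T_def by (intro prod_zero) auto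
    moreover have "x i + x i + x i = 0"
      using card_3_field(1)[OF card3] by (metis distrib_right mult_1 mult_zero_left)
    then have "\<not> (x = y \<and> y = z)" using i by auto
    ultimately show ?thesis by auto
  qed
  obtain h where h: "\<And>e. e \<in> E \<Longrightarrow> (\<Sum>x\<in>B. mon e x * h x) = 0"
    and hc: "card B \<le> card E + card {x\<in>B. h x \<noteq> 0}"
    using exists_solution_large_support[OF fin finE, of mon] by blast
  define S where "S = {x\<in>B. h x \<noteq> 0}"
  \<comment> \<open>Terms with \<open>p1 s\<close> in \<open>E\<close> vanish in the contraction.
    The others are assigned to a slice in y (\<open>\<Omega>2\<close>) or, by \<open>pE\<close>, to
    a slice in z (\<open>\<Omega>3\<close>).\<close>
  define \<Omega>2 where "\<Omega>2 = {s\<in>\<Omega>. p1 s \<notin> E \<and> p2 s \<in> E}"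
  define \<Omega>3 where "\<Omega>3 = {s\<in>\<Omega>. p1 s \<notin> E \<and> p2 s \<notin> E}"
  define H where "H s = cf s * (\<Sum>x\<in>B. mon (p1 s) x * h x)" for s
  \<comment> \<open>One rank-one matrix for each low-degree monomial: \<open>Inl e\<close> collects
    the terms whose y-monomial is \<open>e\<close>, and \<open>Inr e\<close> those whose z-monomial
    is \<open>e\<close>.\<close>
  define u where "u = case_sum mon (\<lambda>e y. \<Sum>s\<in>{s\<in>\<Omega>3. p3 s = e}. H s * mon (p2 s) y)"
  define v where "v = case_sum (\<lambda>e z. \<Sum>s\<in>{s\<in>\<Omega>2. p2 s = e}. H s * mon (p3 s) z) mon"
  have "card S \<le> card (E <+> E)"
  proof (rule card_le_diagonal_rank[where d = h and u = u and v = v])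
    fix y z assume yz: "y \<in> S" "z \<in> S"
    have "(if y = z then h y else 0) = (\<Sum>x\<in>B. if x = y then (if y = z then h x else 0) else 0)"
      using yz fin by (simp add: S_def)
    also have "\<dots> = (\<Sum>x\<in>B. T x y z * h x)"
      using yz by (intro sum.cong) (auto simp: T_diag S_def)
    also have "\<dots> = (\<Sum>x\<in>B. \<Sum>s\<in>\<Omega>. cf s * (mon (p1 s) x * (mon (p2 s) y * mon (p3 s) z)) * h x)"
      by (simp add: T_expand sum_distrib_right)
    also have "\<dots> = (\<Sum>s\<in>\<Omega>. H s * (mon (p2 s) y * mon (p3 s) z))"
      by (subst sum.swap) (simp add: H_def sum_distrib_left sum_distrib_right algebra_simps)
    also have "\<dots> = (\<Sum>s\<in>\<Omega>2 \<union> \<Omega>3. H s * (mon (p2 s) y * mon (p3 s) z))"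
    proof (rule sum.mono_neutral_right)
      show "\<forall>s\<in>\<Omega> - (\<Omega>2 \<union> \<Omega>3). H s * (mon (p2 s) y * mon (p3 s) z) = 0"
        by (auto simp: \<Omega>2_def \<Omega>3_def H_def h)
    qed (use fin\<Omega> in \<open>auto simp: \<Omega>2_def \<Omega>3_def\<close>)
    also have "\<dots> = (\<Sum>s\<in>\<Omega>2. H s * (mon (p2 s) y * mon (p3 s) z)) + (\<Sum>s\<in>\<Omega>3. H s * (mon (p2 s) y * mon (p3 s) z))"
      using fin\<Omega> by (intro sum.union_disjoint) (auto simp: \<Omega>2_def \<Omega>3_def)
    also have "(\<Sum>s\<in>\<Omega>2. H s * (mon (p2 s) y * mon (p3 s) z)) = (\<Sum>e\<in>E. u (Inl e) y * v (Inl e) z)"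
    proof -
      have "(\<Sum>e\<in>E. u (Inl e) y * v (Inl e) z) = (\<Sum>e\<in>E. \<Sum>s\<in>{s\<in>\<Omega>2. p2 s = e}. H s * (mon (p2 s) y * mon (p3 s) z))"
        by (intro sum.cong refl) (auto simp: u_def v_def sum_distrib_left algebra_simps intro!: sum.cong)
      also have "\<dots> = (\<Sum>s\<in>\<Omega>2. H s * (mon (p2 s) y * mon (p3 s) z))"
        using fin\<Omega> finE by (intro sum.group) (auto simp: \<Omega>2_def)
      finally show ?thesis by simp
    qed
    also have "(\<Sum>s\<in>\<Omega>3. H s * (mon (p2 s) y * mon (p3 s) z)) = (\<Sum>e\<in>E. u (Inr e) y * v (Inr e) z)"
    proof -
      have "(\<Sum>e\<in>E. u (Inr e) y * v (Inr e) z) = (\<Sum>e\<in>E. \<Sum>s\<in>{s\<in>\<Omega>3. p3 s = e}. H s * (mon (p2 s) y * mon (p3 s) z))"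
        by (intro sum.cong refl) (simp add: u_def v_def sum_distrib_right mult.assoc)
      also have "\<dots> = (\<Sum>s\<in>\<Omega>3. H s * (mon (p2 s) y * mon (p3 s) z))"
      proof (rule sum.group)
        show "p3 ` \<Omega>3 \<subseteq> E" unfolding \<Omega>3_def using pE by blast
      qed (use fin\<Omega> finE in \<open>auto simp: \<Omega>3_def\<close>)
      finally show ?thesis by simp
    qed
    also have "(\<Sum>e\<in>E. u (Inl e) y * v (Inl e) z) + (\<Sum>e\<in>E. u (Inr e) y * v (Inr e) z) = (\<Sum>k\<in>E <+> E. u k y * v k z)"
      using finE by (simp add: sum.Plus)
    finally show "(\<Sum>k\<in>E <+> E. u k y * v k z) = (if y = z then h y else 0)" by (rule sym)
  qed (use fin finE in \<open>auto simp: S_def simp del: Plus_def\<close>)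
  then show ?thesis using hc card_Plus[OF finE finE] unfolding S_def E_def by linarith
qed

text \<open>Weight each exponent vector by \<open>(1/2)\<close> to the power of its degree.\<close>

lemma card_cap_exponents_le: "real (card (cap_exponents (3 * j))) \<le> (343 / 16) ^ j"
proof -
  let ?P = "{..<3 * j} \<rightarrow>\<^sub>E {..2::nat}"
  have "real (card (cap_exponents (3 * j))) * (1/2) ^ (2 * j) = (\<Sum>e\<in>cap_exponents (3 * j). (1/2::real) ^ (2 * j))"
    by simp
  also have "\<dots> \<le> (\<Sum>e\<in>cap_exponents (3 * j). \<Prod>i<3*j. (1/2::real) ^ e i)"
  proof (intro sum_mono)
    fix e assume "e \<in> cap_exponents (3 * j)"
    then have "(\<Sum>i<3*j. e i) \<le> 2 * j" by (simp add: cap_exponents_def)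
    then show "(1/2::real) ^ (2 * j) \<le> (\<Prod>i<3*j. (1/2) ^ e i)"
      unfolding power_sum[symmetric] by (intro power_decreasing) simp_all
  qed
  also have "\<dots> \<le> (\<Sum>e\<in>?P. \<Prod>i<3*j. (1/2::real) ^ e i)"
  proof (rule sum_mono2)
    show "finite ?P" by (rule finite_PiE) auto
  next
    show "0 \<le> (\<Prod>i<3*j. (1/2::real) ^ e i)" for e :: "nat \<Rightarrow> nat"
      by (rule prod_nonneg) simp
  qed (auto simp: cap_exponents_def)
  also have "\<dots> = (\<Prod>i<3*j. \<Sum>e\<le>2. (1/2::real) ^ e)"
    by (rule prod_sum_PiE[symmetric]) auto
  also have "\<dots> = (7/4) ^ (3 * j)"
    by (simp add: numeral_2_eq_2)
  \<comment> \<open>343/16 is 4 times the cube of 7/4 = 1 + 1/2 + 1/4.\<close>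
  also have "((7/4)::real) ^ (3 * j) = (343/16) ^ j * (1/2) ^ (2 * j)"
    unfolding power_mult power_mult_distrib[symmetric]
    by (rule arg_cong[of _ _ "\<lambda>x. x ^ j"]) (simp add: power3_eq_cube power2_eq_square)
  finally show ?thesis by (rule mult_right_le_imp_le) simp
qed

text \<open>Here \<open>(343/16) ^ 5 <= 3 ^ 14\<close>. The dimension 15 is the least multiple of 3
  at which the preceding bound saves a full factor 3.\<close>

lemma card_cap_exponents_15_le: "card (cap_exponents (15 * i)) \<le> 3 ^ (14 * i)"
proof -
  have "real (card (cap_exponents (15 * i))) \<le> (343 / 16) ^ (5 * i)"
    using card_cap_exponents_le[of "5 * i"] by simp
  also have "(343 / 16) ^ (5 * i) \<le> (3 ^ 14 :: real) ^ i"
    unfolding power_mult by (rule power_mono) (simp_all add: field_simps)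
  also have "(3 ^ 14) ^ i = real (3 ^ (14 * i))"
    by (metis of_nat_numeral of_nat_power power_mult)
  finally show ?thesis using of_nat_le_iff by blast
qed

section \<open>Finite coordinate spaces\<close>

interpretation vs: vector_space "vscale :: 'a::field \<Rightarrow> (nat \<Rightarrow> 'a) \<Rightarrow> (nat \<Rightarrow> 'a)"
  by (rule vscale_vector_space)

lemma card_Fn:
  "finite (Fn m :: (nat \<Rightarrow> 'a::{field,finite}) set)"
  "card (Fn m :: (nat \<Rightarrow> 'a::{field,finite}) set) = card (UNIV :: 'a set) ^ m"
proof -
  let ?F = "Fn m :: (nat \<Rightarrow> 'a) set" and ?P = "{..<m} \<rightarrow>\<^sub>E (UNIV :: 'a set)"
  have b: "bij_betw (\<lambda>v. restrict v {..<m}) ?F ?P"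
  proof (rule bij_betw_byWitness[where f' = "\<lambda>v i. if i < m then v i else 0"])
    show "\<forall>v\<in>?F. (\<lambda>i. if i < m then restrict v {..<m} i else 0) = v"
      by (auto simp: Fn_def fun_eq_iff)
    show "\<forall>v\<in>?P. restrict (\<lambda>i. if i < m then v i else 0) {..<m} = v"
    proof (intro ballI ext)
      fix v and i assume "v \<in> ?P"
      then have "i \<notin> {..<m} \<Longrightarrow> v i = undefined" by (rule PiE_arb)
      then show "restrict (\<lambda>i. if i < m then v i else 0) {..<m} i = v i" by (cases "i < m") simp_all
    qed
    show "(\<lambda>v. restrict v {..<m}) ` ?F \<subseteq> ?P"
      by (intro image_subsetI) (simp add: restrict_PiE_iff)
    show "(\<lambda>v i. if i < m then v i else 0) ` ?P \<subseteq> ?F"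
      by (intro image_subsetI) (simp add: Fn_def)
  qed
  have "finite ?P" by (rule finite_PiE) auto
  then show "finite ?F" using bij_betw_finite[OF b] by simp
  show "card ?F = card (UNIV :: 'a set) ^ m"
    using bij_betw_same_card[OF b] by (simp add: card_PiE)
qed

lemma subspace_Fn: "vs.subspace (Fn n)"
  by (rule vs.subspaceI) (auto simp: Fn_def vscale_def)

section \<open>Supersaturation of lines\<close>

definition avg :: "'b set \<Rightarrow> ('b \<Rightarrow> real) \<Rightarrow> real" where
  "avg V f = (\<Sum>v\<in>V. f v) / card V"

lemma avg_sum: "avg V (\<lambda>v. \<Sum>i\<in>I. f i v) = (\<Sum>i\<in>I. avg V (f i))"
  unfolding avg_def by (subst sum.swap) (simp add: sum_divide_distrib)

lemma avg_swap: "avg V (\<lambda>v. avg W (f v)) = avg W (\<lambda>w. avg V (\<lambda>v. f v w))"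
  unfolding avg_def sum_divide_distrib[symmetric] by (subst sum.swap) (simp add: field_simps)

lemma avg_mono: "(\<And>v. v \<in> V \<Longrightarrow> f v \<le> g v) \<Longrightarrow> avg V f \<le> avg V g"
  unfolding avg_def by (intro divide_right_mono sum_mono) auto

lemma avg_cong: "(\<And>v. v \<in> V \<Longrightarrow> f v = g v) \<Longrightarrow> avg V f = avg V g"
  unfolding avg_def by (metis (mono_tags, lifting) sum.cong)

lemma avg_const: "finite V \<Longrightarrow> V \<noteq> {} \<Longrightarrow> avg V (\<lambda>_. c) = c"
  unfolding avg_def by simp

lemma avg_cmult: "avg V (\<lambda>v. c * f v) = c * avg V f"
  unfolding avg_def by (simp add: sum_distrib_left)

lemma avg_add: "avg V (\<lambda>v. f v + g v) = avg V f + avg V g"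
  unfolding avg_def by (simp add: sum.distrib add_divide_distrib)

lemma avg_nonneg: "(\<And>v. v \<in> V \<Longrightarrow> 0 \<le> f v) \<Longrightarrow> 0 \<le> avg V f"
  unfolding avg_def by (intro divide_nonneg_nonneg sum_nonneg) auto

lemma avg_translate:
  assumes "vs.subspace V" "u \<in> V"
  shows "avg V (\<lambda>v. f (u + v)) = avg V f"
proof -
  have "bij_betw ((+) u) V V"
    by (rule bij_betw_byWitness[where f' = "\<lambda>v. v - u"])
      (use assms in \<open>auto intro: vs.subspace_add vs.subspace_diff\<close>)
  then show ?thesis
    unfolding avg_def using sum.reindex_bij_betw[of "(+) u" V V f] by simp
qed

lemma avg_scale:
  assumes "vs.subspace V" "c \<noteq> 0"
  shows "avg V (\<lambda>v. f (vscale c v)) = avg V f"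
proof -
  have "bij_betw (vscale c) V V"
    by (rule bij_betw_byWitness[where f' = "vscale (inverse c)"])
      (use assms in \<open>auto intro: vs.subspace_scale\<close>)
  then show ?thesis
    unfolding avg_def using sum.reindex_bij_betw[of "vscale c" V V f] by simp
qed

section \<open>Random tuples and random linear maps\<close>

text \<open>Expectation over m independent uniform vectors of V, as an iterated average so that
  linearity and exchange of averages follow by induction. Entries from index m on are 0, so with
  \<open>0 \<in> V\<close> all entries of the tuple lie in V.\<close>

primrec tuple_avg :: "(nat \<Rightarrow> 'a::field) set \<Rightarrow> nat \<Rightarrow> ((nat \<Rightarrow> nat \<Rightarrow> 'a) \<Rightarrow> real) \<Rightarrow> real" where
  "tuple_avg V 0 f = f (\<lambda>_. 0)"
| "tuple_avg V (Suc m) f = avg V (\<lambda>v. tuple_avg V m (\<lambda>D. f (D(m := v))))"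

lemma tuple_avg_sum: "tuple_avg V m (\<lambda>D. \<Sum>i\<in>I. f i D) = (\<Sum>i\<in>I. tuple_avg V m (f i))"
  by (induction m arbitrary: f) (simp_all add: avg_sum)

lemma tuple_avg_avg: "tuple_avg V m (\<lambda>D. avg W (f D)) = avg W (\<lambda>w. tuple_avg V m (\<lambda>D. f D w))"
proof (induction m arbitrary: f)
  case (Suc m)
  have "tuple_avg V m (\<lambda>D. avg W (f (D(m := v)))) = avg W (\<lambda>w. tuple_avg V m (\<lambda>D. f (D(m := v)) w))" for v
    by (rule Suc)
  then show ?case by (simp add: avg_swap[of V W])
qed simp

lemma tuple_avg_mono:
  assumes "0 \<in> V" "\<And>D. (\<And>j. D j \<in> V) \<Longrightarrow> f D \<le> g D"
  shows "tuple_avg V m f \<le> tuple_avg V m g"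
  using assms(2)
proof (induction m arbitrary: f g)
  case (Suc m)
  show ?case unfolding tuple_avg.simps
  proof (rule avg_mono, rule Suc.IH)
    fix v and D :: "nat \<Rightarrow> nat \<Rightarrow> 'a"
    assume "v \<in> V" "\<And>j. D j \<in> V"
    then show "f (D(m := v)) \<le> g (D(m := v))" by (intro Suc.prems) auto
  qed
qed (use assms(1) in auto)

lemma tuple_avg_cong:
  assumes "0 \<in> V" "\<And>D. (\<And>j. D j \<in> V) \<Longrightarrow> f D = g D"
  shows "tuple_avg V m f = tuple_avg V m g"
  using assms by (intro antisym tuple_avg_mono) auto

lemma tuple_avg_const: "finite V \<Longrightarrow> V \<noteq> {} \<Longrightarrow> tuple_avg V m (\<lambda>_. c) = c"
  by (induction m) (simp_all add: avg_const)

lemma tuple_avg_add: "tuple_avg V m (\<lambda>D. f D + g D) = tuple_avg V m f + tuple_avg V m g"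
  by (induction m arbitrary: f g) (simp_all add: avg_add)

text \<open>Image of \<open>y\<close> under the linear map that sends the j-th unit vector to
  \<open>D j\<close>; a random \<open>D\<close> gives a random linear map.\<close>

definition lincomb :: "nat \<Rightarrow> (nat \<Rightarrow> 'a::field) \<Rightarrow> (nat \<Rightarrow> nat \<Rightarrow> 'a) \<Rightarrow> nat \<Rightarrow> 'a" where
  "lincomb m y D = (\<Sum>j<m. vscale (y j) (D j))"

lemma lincomb_in: "vs.subspace V \<Longrightarrow> (\<And>j. D j \<in> V) \<Longrightarrow> lincomb m y D \<in> V"
  unfolding lincomb_def by (intro vs.subspace_sum vs.subspace_scale) auto

lemma lincomb_upd: "lincomb (Suc m) y (D(m := v)) = lincomb m y D + vscale (y m) v"
  unfolding lincomb_def by simp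

lemma lincomb_line: "lincomb m (y + vscale c d) D = lincomb m y D + vscale c (lincomb m d D)"
  unfolding lincomb_def vs.scale_sum_right sum.distrib[symmetric]
  by (intro sum.cong) (auto simp: vscale_def fun_eq_iff algebra_simps)

text \<open>A random linear map sends a fixed nonzero vector to a uniform one: if the last
  coefficient is nonzero, the last random vector alone is uniform after scaling and translation;
  otherwise it drops out and induction applies.\<close>

lemma tuple_avg_lincomb:
  assumes V: "vs.subspace V" "finite V" and "j < m" "y j \<noteq> 0"
  shows "tuple_avg V m (\<lambda>D. f (lincomb m y D)) = avg V f"
  using assms(3,4)
proof (induction m)
  case (Suc m)
  have V0: "0 \<in> V" using V(1) by (rule vs.subspace_0)
  have Vne: "V \<noteq> {}" using V0 by auto
  show ?case
  proof (cases "y m = 0")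
    case True
    then have "j < m" using Suc.prems by (metis less_antisym)
    then show ?thesis
      using Suc True V(2) Vne by (simp add: lincomb_upd avg_const)
  next
    case False
    have "tuple_avg V (Suc m) (\<lambda>D. f (lincomb (Suc m) y D))
        = tuple_avg V m (\<lambda>D. avg V (\<lambda>v. f (lincomb m y D + vscale (y m) v)))"
      by (simp add: lincomb_upd tuple_avg_avg)
    also have "\<dots> = tuple_avg V m (\<lambda>D. avg V f)"
    proof (rule tuple_avg_cong[OF V0])
      fix D :: "nat \<Rightarrow> nat \<Rightarrow> 'a" assume "\<And>j. D j \<in> V"
      then have "lincomb m y D \<in> V" by (rule lincomb_in[OF V(1)])
      then show "avg V (\<lambda>v. f (lincomb m y D + vscale (y m) v)) = avg V f"
        using avg_scale[OF V(1) False, of "\<lambda>v. f (lincomb m y D + v)"] avg_translate[OF V(1)] by simp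
    qed
    finally show ?thesis using tuple_avg_const V(2) Vne by metis
  qed
qed simp

text \<open>Passing from A to this set fixes d as one direction of the affine subspace under
  construction. For d = 0 it is A itself.\<close>

definition line_kernel :: "(nat \<Rightarrow> 'a::field) set \<Rightarrow> (nat \<Rightarrow> 'a) \<Rightarrow> (nat \<Rightarrow> 'a) set" where
  "line_kernel A d = {x. \<forall>c. x + vscale c d \<in> A}"

definition dens :: "'b set \<Rightarrow> 'b set \<Rightarrow> real" where
  "dens V A = avg V (\<lambda>x. of_bool (x \<in> A))"

lemma dens_nonneg: "0 \<le> dens V A"
  unfolding dens_def by (rule avg_nonneg) simp

lemma dens_le_1: "dens V A \<le> 1"
proof -
  have "dens V A \<le> avg V (\<lambda>_. 1)" unfolding dens_def by (rule avg_mono) simp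
  also have "\<dots> \<le> 1" by (simp add: avg_def)
  finally show ?thesis .
qed

lemma dens_eq_card: "finite V \<Longrightarrow> dens V A = card (V \<inter> A) / card V"
  by (simp add: dens_def avg_def of_bool_def sum.If_cases)

text \<open>Over two elements a line is the pair x, x + d, and for fixed x the point x + d is
  uniform in V, so the average factors exactly.\<close>

lemma avg_dens_line_kernel_2:
  fixes A :: "(nat \<Rightarrow> 'a::{field,finite}) set"
  assumes q: "card (UNIV :: 'a set) = 2" and V: "vs.subspace V"
  shows "avg V (\<lambda>d. dens V (line_kernel A d)) = dens V A ^ 2"
proof -
  have "UNIV = {0, 1::'a}"
    using q by (intro card_subset_eq[symmetric]) auto
  then have c: "c = 0 \<or> c = 1" for c :: 'a by auto
  have "x \<in> line_kernel A d \<longleftrightarrow> x \<in> A \<and> x + d \<in> A" for x d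
  proof
    assume "x \<in> line_kernel A d"
    then have "x + vscale 0 d \<in> A" "x + vscale 1 d \<in> A" unfolding line_kernel_def by blast+
    then show "x \<in> A \<and> x + d \<in> A" by simp
  next
    assume "x \<in> A \<and> x + d \<in> A"
    then have "x + vscale c d \<in> A" for c using c[of c] by auto
    then show "x \<in> line_kernel A d" by (simp add: line_kernel_def)
  qed
  then have "avg V (\<lambda>d. dens V (line_kernel A d)) = avg V (\<lambda>d. avg V (\<lambda>x. of_bool (x \<in> A) * of_bool (x + d \<in> A)))"
    unfolding dens_def by (simp add: of_bool_conj)
  also have "\<dots> = avg V (\<lambda>x. of_bool (x \<in> A) * avg V (\<lambda>d. of_bool (x + d \<in> A)))"
    by (subst avg_swap) (simp add: avg_cmult)
  also have "\<dots> = avg V (\<lambda>x. dens V A * of_bool (x \<in> A))"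
    unfolding dens_def using avg_translate[OF V, of _ "\<lambda>x. of_bool (x \<in> A)"]
    by (intro avg_cong) simp
  finally show ?thesis by (simp add: avg_cmult dens_def power2_eq_square)
qed

section \<open>Counting lines over the field with three elements\<close>

definition line_pairs :: "nat \<Rightarrow> (nat \<Rightarrow> 'a::field) set \<Rightarrow> ((nat \<Rightarrow> 'a) \<times> (nat \<Rightarrow> 'a)) set" where
  "line_pairs m B = {(y, d) \<in> Fn m \<times> (Fn m - {0}). y \<in> line_kernel B d}"

text \<open>Delete a point from a line inside B as long as there is one. Each deletion destroys at
  least one pair, and what remains is a cap set.\<close>

lemma card_le_line_pairs:
  fixes B :: "(nat \<Rightarrow> 'a::{field,finite}) set"
  assumes card3: "card (UNIV :: 'a set) = 3" and "B \<subseteq> Fn m"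
  shows "card B \<le> card (line_pairs m B) + 3 * card (cap_exponents m)"
proof -
  have fin: "finite (line_pairs m B)" for B :: "(nat \<Rightarrow> 'a) set"
    by (rule finite_subset[of _ "Fn m \<times> Fn m"]) (auto simp: line_pairs_def card_Fn)
  have "finite B" using assms(2) card_Fn(1) by (rule finite_subset)
  then show ?thesis using assms(2)
  proof (induction B rule: finite_psubset_induct)
    case (psubset B)
    show ?case
    proof (cases "\<forall>y d. d \<noteq> 0 \<longrightarrow> (\<exists>c. y + vscale c d \<notin> B)")
      case True
      then show ?thesis using cap_set_card_le[OF card3 psubset.hyps(1) psubset.prems] by simp
    next
      case False
      then obtain y d where yd: "d \<noteq> 0" "\<And>c. y + vscale c d \<in> B" by blast
      have y: "y \<in> B" using yd(2)[of 0] by simp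
      have "y + vscale 1 d \<in> B" by (rule yd)
      \<comment> \<open>The cap condition ranges over all directions, so membership of d in
        \<open>Fn m\<close> comes from two points of its line.\<close>
      then have "(y + d) - y \<in> Fn m"
        using y psubset.prems by (intro vs.subspace_diff subspace_Fn) auto
      then have pair: "(y, d) \<in> line_pairs m B"
        using yd y psubset.prems by (auto simp: line_pairs_def line_kernel_def)
      have "(y, d) \<notin> line_pairs m (B - {y})"
        using y by (auto simp: line_pairs_def line_kernel_def intro!: exI[of _ 0])
      moreover have "line_pairs m (B - {y}) \<subseteq> line_pairs m B"
        by (auto simp: line_pairs_def line_kernel_def)
      ultimately have "card (line_pairs m (B - {y})) < card (line_pairs m B)"
        using pair fin by (intro psubset_card_mono) auto
      moreover have "card (B - {y}) \<le> card (line_pairs m (B - {y})) + 3 * card (cap_exponents m)"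
        using y psubset.prems by (intro psubset.IH) auto
      moreover have "card B = Suc (card (B - {y}))"
        using psubset.hyps(1) y by (rule card.remove)
      ultimately show ?thesis by linarith
    qed
  qed
qed

text \<open>Pull the set back along a random affine map from \<open>Fn m\<close> and count lines in the preimage.\<close>

lemma dens_le_line_dens_3:
  fixes A :: "(nat \<Rightarrow> 'a::{field,finite}) set"
  assumes q: "card (UNIV :: 'a set) = 3" and V: "vs.subspace V" "finite V"
  shows "3 ^ m * dens V A \<le> (3 ^ m)\<^sup>2 * avg V (\<lambda>d. dens V (line_kernel A d)) + 3 * real (card (cap_exponents m))"
proof -
  let ?F = "Fn m :: (nat \<Rightarrow> 'a) set"
  define \<delta> where "\<delta> = avg V (\<lambda>d. dens V (line_kernel A d))"
  have V0: "0 \<in> V" using V(1) by (rule vs.subspace_0)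
  have Vne: "V \<noteq> {}" using V0 by auto
  have finP: "finite (?F \<times> (?F - {0}))" by (auto simp: card_Fn)
  have shift: "avg V (\<lambda>x. of_bool (x + w \<in> B)) = dens V B" if "w \<in> V" for w B
    using avg_translate[OF V(1) that, of "\<lambda>x. of_bool (x \<in> B)"] by (simp add: dens_def add.commute)
  \<comment> \<open>For a fixed map, B is the preimage of A. Lines in B go to lines in A, possibly
    degenerate ones, which \<open>line_kernel\<close> counts as well.\<close>
  have pt: "(\<Sum>y\<in>?F. of_bool (x + lincomb m y D \<in> A))
      \<le> (\<Sum>(y,d)\<in>?F \<times> (?F - {0}). of_bool (x + lincomb m y D \<in> line_kernel A (lincomb m d D)))
        + 3 * real (card (cap_exponents m))" for x and D :: "nat \<Rightarrow> nat \<Rightarrow> 'a"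
  proof -
    define B where "B = {y \<in> ?F. x + lincomb m y D \<in> A}"
    have "real (card (line_pairs m B))
        \<le> real (card {p \<in> ?F \<times> (?F - {0}). x + lincomb m (fst p) D \<in> line_kernel A (lincomb m (snd p) D)})"
      using finP by (intro of_nat_mono card_mono finite_subset[OF _ finP])
        (auto simp: line_pairs_def line_kernel_def B_def lincomb_line add.assoc)
    also have "\<dots> = (\<Sum>(y,d)\<in>?F \<times> (?F - {0}). of_bool (x + lincomb m y D \<in> line_kernel A (lincomb m d D)))"
      using finP by (simp add: of_bool_def sum.If_cases Int_def case_prod_unfold)
    finally have pairs: "real (card (line_pairs m B)) \<le> \<dots>" .
    have "(\<Sum>y\<in>?F. of_bool (x + lincomb m y D \<in> A)) = real (card B)"
      by (simp add: of_bool_def sum.If_cases card_Fn B_def Int_def)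
    also have "\<dots> \<le> real (card (line_pairs m B) + 3 * card (cap_exponents m))"
      by (intro of_nat_mono card_le_line_pairs[OF q]) (auto simp: B_def)
    also have "\<dots> = real (card (line_pairs m B)) + 3 * real (card (cap_exponents m))"
      by simp
    also note add_right_mono[OF pairs]
    finally show ?thesis .
  qed
  have "3 ^ m * dens V A = (\<Sum>y\<in>?F. tuple_avg V m (\<lambda>D. dens V A))"
    using V(2) Vne by (simp add: tuple_avg_const card_Fn q)
  also have "\<dots> = (\<Sum>y\<in>?F. tuple_avg V m (\<lambda>D. avg V (\<lambda>x. of_bool (x + lincomb m y D \<in> A))))"
    by (intro sum.cong refl tuple_avg_cong[OF V0]) (simp add: shift lincomb_in[OF V(1)])
  also have "\<dots> = tuple_avg V m (\<lambda>D. avg V (\<lambda>x. \<Sum>y\<in>?F. of_bool (x + lincomb m y D \<in> A)))"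
    by (simp add: tuple_avg_sum avg_sum)
  also have "\<dots> \<le> tuple_avg V m (\<lambda>D. avg V (\<lambda>x. (\<Sum>p\<in>?F \<times> (?F - {0}).
        of_bool (x + lincomb m (fst p) D \<in> line_kernel A (lincomb m (snd p) D)))
        + 3 * real (card (cap_exponents m))))"
    using pt by (intro tuple_avg_mono[OF V0] avg_mono) (simp add: case_prod_unfold)
  also have "\<dots> = (\<Sum>p\<in>?F \<times> (?F - {0}). tuple_avg V m (\<lambda>D. avg V (\<lambda>x.
        of_bool (x + lincomb m (fst p) D \<in> line_kernel A (lincomb m (snd p) D)))))
        + 3 * real (card (cap_exponents m))"
    by (simp only: avg_add tuple_avg_add avg_const[OF V(2) Vne] tuple_avg_const[OF V(2) Vne] avg_sum tuple_avg_sum)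
  also have "(\<Sum>p\<in>?F \<times> (?F - {0}). tuple_avg V m (\<lambda>D. avg V (\<lambda>x.
        of_bool (x + lincomb m (fst p) D \<in> line_kernel A (lincomb m (snd p) D)))))
      = (\<Sum>p\<in>?F \<times> (?F - {0}). \<delta>)"
  proof (rule sum.cong[OF refl])
    \<comment> \<open>Since d is nonzero, its image is a uniform direction, and the translation x
      makes the base point uniform for every choice of \<open>D\<close>. Hence every pair
      contributes exactly \<delta>.\<close>
    fix p assume p: "p \<in> ?F \<times> (?F - {0})"
    then have "snd p \<noteq> 0" by auto
    then obtain j where "snd p j \<noteq> (0 :: nat \<Rightarrow> 'a) j" by (meson ext)
    then have j: "snd p j \<noteq> 0" by simp
    have "j < m"
    proof (rule ccontr)
      assume "\<not> j < m"
      then show False using p j by (auto simp: Fn_def)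
    qed
    have "tuple_avg V m (\<lambda>D. avg V (\<lambda>x. of_bool (x + lincomb m (fst p) D \<in> line_kernel A (lincomb m (snd p) D))))
        = tuple_avg V m (\<lambda>D. dens V (line_kernel A (lincomb m (snd p) D)))"
      by (intro tuple_avg_cong[OF V0]) (simp add: shift lincomb_in[OF V(1)])
    also have "\<dots> = \<delta>"
      unfolding \<delta>_def using tuple_avg_lincomb[where y = "snd p" and j = j, OF V \<open>j < m\<close> j, of "\<lambda>w. dens V (line_kernel A w)"] .
    finally show "tuple_avg V m (\<lambda>D. avg V (\<lambda>x. of_bool (x + lincomb m (fst p) D \<in> line_kernel A (lincomb m (snd p) D)))) = \<delta>" .
  qed
  also have "(\<Sum>p\<in>?F \<times> (?F - {0}). \<delta>) + 3 * real (card (cap_exponents m))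
      \<le> (3 ^ m)\<^sup>2 * \<delta> + 3 * real (card (cap_exponents m))"
  proof (rule add_right_mono)
    have "card (?F \<times> (?F - {0})) \<le> card (?F \<times> ?F)"
      by (intro card_mono) (auto simp: card_Fn)
    also have "\<dots> = (3 ^ m)\<^sup>2" by (simp add: card_cartesian_product card_Fn q power2_eq_square)
    finally have "real (card (?F \<times> (?F - {0}))) \<le> real ((3 ^ m)\<^sup>2)" by (rule of_nat_mono)
    moreover have "0 \<le> \<delta>" unfolding \<delta>_def by (intro avg_nonneg dens_nonneg)
    ultimately show "(\<Sum>p\<in>?F \<times> (?F - {0}). \<delta>) \<le> (3 ^ m)\<^sup>2 * \<delta>"
      by (simp add: mult_right_mono)
  qed
  finally show ?thesis unfolding \<delta>_def .
qed

text \<open>Dividing densities by 27 absorbs the constant lost, so that the inequality can be iterated.\<close>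

lemma avg_dens_line_kernel_3:
  fixes A :: "(nat \<Rightarrow> 'a::{field,finite}) set"
  assumes q: "card (UNIV :: 'a set) = 3" and V: "vs.subspace V" "finite V"
  shows "(dens V A / 27) ^ 16 \<le> avg V (\<lambda>d. dens V (line_kernel A d) / 27)"
proof -
  define \<alpha> where "\<alpha> = dens V A"
  define \<delta> where "\<delta> = avg V (\<lambda>d. dens V (line_kernel A d))"
  have \<delta>0: "0 \<le> \<delta>" unfolding \<delta>_def by (intro avg_nonneg dens_nonneg)
  have \<delta>27: "avg V (\<lambda>d. dens V (line_kernel A d) / 27) = \<delta> / 27"
    using avg_cmult[of V "1/27"] by (simp add: \<delta>_def)
  show ?thesis
  proof (cases "\<alpha> = 0")
    case True
    then show ?thesis using \<delta>0 by (simp add: \<delta>27 \<alpha>_def)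
  next
    case False
    then have \<alpha>: "0 < \<alpha>" "\<alpha> \<le> 1" using dens_nonneg[of V A] dens_le_1[of V A] by (auto simp: \<alpha>_def)
    obtain i0 where "6 / \<alpha> < 3 ^ i0" using real_arch_pow[of 3 "6 / \<alpha>"] by auto
    then have ex: "6 \<le> \<alpha> * 3 ^ i0" using \<alpha> by (simp add: field_simps)
    \<comment> \<open>By minimality \<alpha> * \<open>3 ^ i\<close> lies between 6 and 18. The lower
      bound makes the cap set term at most half of the main term; the upper bound limits the loss in
      the exponent.\<close>
    define i where "i = (LEAST i. 6 \<le> \<alpha> * 3 ^ i)"
    have i: "6 \<le> \<alpha> * 3 ^ i" unfolding i_def using ex by (rule LeastI)
    have "i \<noteq> 0" using i \<alpha> by (cases "i = 0") auto
    then obtain k where k: "i = Suc k" by (cases i) auto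
    then have "\<not> 6 \<le> \<alpha> * 3 ^ k" using not_less_Least[of k "\<lambda>i. 6 \<le> \<alpha> * 3 ^ i"] by (simp add: i_def)
    then have i18: "\<alpha> * 3 ^ i \<le> 18" by (simp add: k)
    define X :: real where "X = 3 ^ i"
    have X: "0 < X" "6 \<le> \<alpha> * X" "\<alpha> * X \<le> 18" using i i18 by (auto simp: X_def)
    have X15: "3 ^ (15 * i) = X ^ 15" and X14: "3 ^ (14 * i) = X ^ 14"
      unfolding X_def power_mult[symmetric] by (simp_all only: mult.commute)
    have XX: "X ^ 15 = X * X ^ 14" using power_Suc[of X 14] by simp
    have "3 ^ (15 * i) * \<alpha> \<le> (3 ^ (15 * i))\<^sup>2 * \<delta> + 3 * real (card (cap_exponents (15 * i)))"
      unfolding \<alpha>_def \<delta>_def by (rule dens_le_line_dens_3[OF q V])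
    also have "real (card (cap_exponents (15 * i))) \<le> real (3 ^ (14 * i))"
      by (rule of_nat_mono) (rule card_cap_exponents_15_le)
    finally have "X ^ 15 * \<alpha> \<le> (X ^ 15)\<^sup>2 * \<delta> + 3 * X ^ 14"
      unfolding X15 by (simp add: X14)
    moreover have "6 * X ^ 14 \<le> X ^ 15 * \<alpha>"
    proof -
      have "6 * X ^ 14 \<le> \<alpha> * X * X ^ 14" using X by (intro mult_right_mono) auto
      also have "\<dots> = X ^ 15 * \<alpha>" by (simp only: XX mult_ac)
      finally show ?thesis .
    qed
    moreover have "X ^ 15 * (2 * (X ^ 15 * \<delta>)) = 2 * ((X ^ 15)\<^sup>2 * \<delta>)"
      by (simp only: power2_eq_square mult_ac)
    ultimately have "X ^ 15 * \<alpha> \<le> X ^ 15 * (2 * (X ^ 15 * \<delta>))"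
      by linarith
    then have a: "\<alpha> \<le> 2 * (X ^ 15 * \<delta>)"
      using X(1) by (subst (asm) mult_le_cancel_left_pos) auto
    have "\<alpha> ^ 16 = \<alpha> ^ 15 * \<alpha>" using power_Suc2[of \<alpha> 15] by simp
    also have "\<dots> \<le> \<alpha> ^ 15 * (2 * (X ^ 15 * \<delta>))"
      using a \<alpha> by (intro mult_left_mono) auto
    also have "\<dots> = 2 * ((\<alpha> * X) ^ 15 * \<delta>)" by (simp only: power_mult_distrib mult_ac)
    also have "\<dots> \<le> 2 * (18 ^ 15 * \<delta>)"
      using X \<alpha> \<delta>0 by (intro mult_left_mono mult_right_mono power_mono) auto
    \<comment> \<open>27 is the least power of 3 whose 15th power exceeds
      \<open>2 * 18 ^ 15\<close>; being a power of 3, it fits the normalisation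
      \<open>1 / q ^ e\<close> with e = 3.\<close>
    also have "\<dots> \<le> 27 ^ 15 * \<delta>" using \<delta>0 by simp
    finally have "\<alpha> ^ 16 / 27 ^ 16 \<le> 27 ^ 15 * \<delta> / 27 ^ 16"
      by (rule divide_right_mono) simp
    also have "\<dots> = \<delta> / 27" by simp
    finally show ?thesis unfolding \<delta>27 \<alpha>_def power_divide .
  qed
qed

section \<open>Affine subspaces of dense sets and the recursion\<close>

lemma card_field_ge_2: "2 \<le> card (UNIV :: 'a::{field,finite} set)"
  using card_mono[of "UNIV :: 'a set" "{0,1}"] by simp

lemma card_span_insert:
  fixes a :: "nat \<Rightarrow> 'a::{field,finite}"
  assumes fin: "finite (vs.span S)" and a: "a \<notin> vs.span S"
  shows "finite (vs.span (insert a S))"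
    and "card (vs.span (insert a S)) = card (UNIV :: 'a set) * card (vs.span S)"
proof -
  let ?f = "\<lambda>(c, v). vscale c a + v"
  have img: "vs.span (insert a S) = ?f ` (UNIV \<times> vs.span S)"
  proof (intro equalityI subsetI)
    fix x assume "x \<in> vs.span (insert a S)"
    then obtain k where k: "x - vscale k a \<in> vs.span S" using vs.span_breakdown_eq by blast
    have "x = ?f (k, x - vscale k a)" by simp
    then show "x \<in> ?f ` (UNIV \<times> vs.span S)" using k by blast
  next
    fix x assume "x \<in> ?f ` (UNIV \<times> vs.span S)"
    then obtain c v where "x = vscale c a + v" "v \<in> vs.span S" by auto
    then show "x \<in> vs.span (insert a S)"
      using vs.span_breakdown_eq[of x a S] by (metis add_diff_cancel_left')
  qed
  then show "finite (vs.span (insert a S))" using fin by simp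
  have "inj_on ?f (UNIV \<times> vs.span S)"
  proof (rule inj_onI, clarify)
    fix c v d w
    assume vw: "v \<in> vs.span S" "w \<in> vs.span S" and eq: "vscale c a + v = vscale d a + w"
    have "vscale (c - d) a = w - v"
      using eq by (simp add: vs.scale_left_diff_distrib algebra_simps)
    then have in_span: "vscale (c - d) a \<in> vs.span S" using vw by (simp add: vs.span_diff)
    have "c = d"
    proof (rule ccontr)
      assume "c \<noteq> d"
      then have "vscale (inverse (c - d)) (vscale (c - d) a) = a" by simp
      then show False using a vs.span_scale[OF in_span, of "inverse (c - d)"] by simp
    qed
    then show "c = d \<and> v = w" using eq by simp
  qed
  then show "card (vs.span (insert a S)) = card (UNIV :: 'a set) * card (vs.span S)"
    unfolding img by (simp add: card_image card_cartesian_product)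
qed

lemma card_span_independent:
  fixes S :: "(nat \<Rightarrow> 'a::{field,finite}) set"
  assumes "finite S" "vs.independent S"
  shows "finite (vs.span S)" and "card (vs.span S) = card (UNIV :: 'a set) ^ card S"
proof -
  have "finite (vs.span S) \<and> card (vs.span S) = card (UNIV :: 'a set) ^ card S"
    using assms
  proof (induction S rule: finite_induct)
    case (insert a S)
    then have "a \<notin> vs.span S" "vs.independent S" by (simp_all add: vs.independent_insert)
    then show ?case using insert card_span_insert[of S a] by simp
  qed simp
  then show "finite (vs.span S)" and "card (vs.span S) = card (UNIV :: 'a set) ^ card S" by auto
qed

lemma card_subspace:
  fixes V :: "(nat \<Rightarrow> 'a::{field,finite}) set"
  assumes "vs.subspace V" "finite V"
  shows "card V = card (UNIV :: 'a set) ^ vs.dim V"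
proof -
  obtain B where B: "B \<subseteq> V" "vs.independent B" "V \<subseteq> vs.span B" "card B = vs.dim V"
    using vs.basis_exists by blast
  have "vs.span B = V" using B assms(1) by (simp add: antisym vs.span_minimal)
  then show ?thesis using card_span_independent(2)[of B] B assms(2) finite_subset by metis
qed

lemma subspace_dim_eqI:
  fixes V :: "(nat \<Rightarrow> 'a::{field,finite}) set"
  assumes "vs.subspace V" "finite V" "card V = card (UNIV :: 'a set) ^ k"
  shows "vs.dim V = k"
  using card_subspace[OF assms(1,2)] assms(3) card_field_ge_2[where 'a = 'a] power_inject_exp[of "card (UNIV :: 'a set)"]
  by simp

lemma exists_subspace_of_card:
  fixes V :: "(nat \<Rightarrow> 'a::{field,finite}) set"
  assumes "vs.subspace V" "finite V" "k \<le> vs.dim V"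
  shows "\<exists>U\<subseteq>V. vs.subspace U \<and> card U = card (UNIV :: 'a set) ^ k"
proof -
  obtain B where B: "B \<subseteq> V" "vs.independent B" "V \<subseteq> vs.span B" "card B = vs.dim V"
    using vs.basis_exists by blast
  obtain T where T: "T \<subseteq> B" "card T = k"
    using assms(3) B(4) obtain_subset_with_card_n by metis
  have "finite T" using T B assms(2) finite_subset by metis
  moreover have "vs.independent T" using T B vs.independent_mono by blast
  moreover have "vs.span T \<subseteq> V" using T B assms(1) by (intro vs.span_minimal) auto
  ultimately show ?thesis using card_span_independent(2)[of T] T(2) by (intro exI[of _ "vs.span T"]) auto
qed

section \<open>Convexity and the iteration over directions\<close>

text \<open>The tangent at a lies below the convex power function. In the induction, multiplying by
  x costs exactly a nonnegative multiple of \<open>(x - a)\<^sup>2\<close>.\<close>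

lemma power_ge_tangent:
  fixes x a :: real
  assumes "0 \<le> x" "0 \<le> a"
  shows "a ^ Suc n + real (Suc n) * a ^ n * (x - a) \<le> x ^ Suc n"
proof (induction n)
  case (Suc n)
  have "a ^ Suc (Suc n) + real (Suc (Suc n)) * a ^ Suc n * (x - a)
      = x * (a ^ Suc n + real (Suc n) * a ^ n * (x - a)) - real (Suc n) * a ^ n * (x - a)\<^sup>2"
    by (simp add: algebra_simps power2_eq_square)
  also have "\<dots> \<le> x * (a ^ Suc n + real (Suc n) * a ^ n * (x - a))"
    using assms by simp
  also have "\<dots> \<le> x * x ^ Suc n" using Suc assms by (intro mult_left_mono) auto
  finally show ?case by simp
qed simp

text \<open>Jensen's inequality, by averaging the tangent at the mean.\<close>

lemma power_avg_le:
  assumes V: "finite V" "V \<noteq> {}" and f: "\<And>v. v \<in> V \<Longrightarrow> 0 \<le> f v"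
  shows "avg V f ^ k \<le> avg V (\<lambda>v. f v ^ k)"
proof (cases k)
  case 0
  then show ?thesis using V by (simp add: avg_const)
next
  case (Suc n)
  let ?a = "avg V f"
  have a: "0 \<le> ?a" using f by (rule avg_nonneg)
  have "avg V (\<lambda>v. (?a ^ Suc n - real (Suc n) * ?a ^ n * ?a) + real (Suc n) * ?a ^ n * f v) \<le> avg V (\<lambda>v. f v ^ Suc n)"
    using power_ge_tangent[OF f a] by (intro avg_mono) (simp add: algebra_simps)
  then show ?thesis unfolding Suc avg_add avg_cmult avg_const[OF V] by simp
qed

text \<open>Induction on k, keeping A invariant under the span of the directions \<open>S0\<close>
  already chosen; once k = 0, any point of A in V is a suitable x. The left side of the last
  hypothesis bounds the total share of directions lying in the successive spans, of which there are
  \<open>q ^ card S0\<close>, \<open>q ^ (card S0 + 1)\<close> and so on, k terms in all.\<close>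

lemma exists_affine_subspace:
  fixes V :: "(nat \<Rightarrow> 'a::{field,finite}) set" and \<kappa> :: real
  defines "q \<equiv> card (UNIV :: 'a set)"
  assumes V: "vs.subspace V" "finite V" and \<kappa>: "0 < \<kappa>" "\<kappa> \<le> 1"
    and step: "\<And>A. (\<kappa> * dens V A) ^ C \<le> avg V (\<lambda>d. \<kappa> * dens V (line_kernel A d))"
    and "vs.independent S0" "S0 \<subseteq> V" "\<And>x v. x \<in> A \<Longrightarrow> v \<in> vs.span S0 \<Longrightarrow> x + v \<in> A"
    and "(real q ^ k - 1) * real q ^ card S0 / card V < (\<kappa> * dens V A) ^ (C ^ k)"
  shows "\<exists>S x. S \<subseteq> V \<and> vs.independent S \<and> card S = card S0 + k \<and> x \<in> V \<and> (\<forall>v\<in>vs.span S. x + v \<in> A)"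
  using assms(7-10)
proof (induction k arbitrary: S0 A)
  case 0
  then have "dens V A \<noteq> 0" using \<kappa> by auto
  then obtain x where "x \<in> V" "x \<in> A" using V(2) by (auto simp: dens_eq_card)
  then show ?case using 0 by (intro exI[of _ S0] exI[of _ x]) auto
next
  case (Suc k)
  define W where "W = vs.span S0"
  define \<mu> where "\<mu> d = \<kappa> * dens V (line_kernel A d)" for d
  have V0: "V \<noteq> {}" using vs.subspace_0[OF V(1)] by auto
  have cV: "0 < real (card V)" using V(2) V0 by (simp add: card_gt_0_iff)
  have q2: "2 \<le> real q" using card_field_ge_2[where 'a = 'a] unfolding q_def by linarith
  have WV: "W \<subseteq> V" unfolding W_def using Suc.prems(2) V(1) by (rule vs.span_minimal)
  have finS0: "finite S0" using Suc.prems(2) V(2) by (rule finite_subset)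
  have cW: "real (card W) = real q ^ card S0"
    using card_span_independent(2)[OF finS0 Suc.prems(1)] by (simp add: W_def q_def)
  have \<mu>01: "0 \<le> \<mu> d" "\<mu> d \<le> 1" for d
    unfolding \<mu>_def using \<kappa> by (simp_all add: dens_nonneg dens_le_1 mult_le_one)
  \<comment> \<open>The threshold demanded by the induction hypothesis once one more direction is in
    the basis.\<close>
  define \<tau> where "\<tau> = (real q ^ k - 1) * real q ^ Suc (card S0) / card V"
  have \<tau>0: "0 \<le> \<tau>" unfolding \<tau>_def using q2 by (intro divide_nonneg_nonneg mult_nonneg_nonneg) (auto intro: one_le_power)
  \<comment> \<open>Otherwise the average of \<open>\<mu> d ^ (C ^ k)\<close> is at most the share
    of W plus \<tau>, whereas \<open>step\<close> and Jensen's inequality bound it below by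
    \<open>(\<kappa> * dens V A) ^ (C ^ Suc k)\<close>. Comparing the two thresholds uses q >=
    2.\<close>
  have "\<exists>d\<in>V - W. \<tau> < \<mu> d ^ (C ^ k)"
  proof (rule ccontr)
    assume neg: "\<not> ?thesis"
    have "(\<kappa> * dens V A) ^ (C ^ Suc k) = ((\<kappa> * dens V A) ^ C) ^ (C ^ k)"
      by (simp add: power_mult)
    also have "\<dots> \<le> avg V \<mu> ^ (C ^ k)"
      unfolding \<mu>_def using step \<kappa> by (intro power_mono) (auto simp: dens_nonneg)
    also have "\<dots> \<le> avg V (\<lambda>d. \<mu> d ^ (C ^ k))"
      using V(2) V0 \<mu>01(1) by (rule power_avg_le)
    also have "\<dots> \<le> avg V (\<lambda>d. of_bool (d \<in> W) + \<tau>)"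
    proof (rule avg_mono)
      fix d assume d: "d \<in> V"
      show "\<mu> d ^ (C ^ k) \<le> of_bool (d \<in> W) + \<tau>"
      proof (cases "d \<in> W")
        case True
        have "\<mu> d ^ (C ^ k) \<le> 1" using \<mu>01 by (rule power_le_one)
        then show ?thesis using True \<tau>0 by simp
      next
        case False
        then have "\<not> \<tau> < \<mu> d ^ (C ^ k)" using neg d by blast
        then show ?thesis using False by simp
      qed
    qed
    also have "\<dots> = dens V W + \<tau>"
      using V(2) V0 by (simp add: avg_add avg_const dens_def)
    also have "dens V W = real q ^ card S0 / card V"
      using V(2) WV by (simp add: dens_eq_card Int_absorb1 cW)
    also have "real q ^ card S0 / card V + \<tau> \<le> (real q ^ Suc k - 1) * real q ^ card S0 / card V"
    proof -
      have "real q ^ card S0 * (2 - real q) \<le> 0" using q2 by (simp add: mult_le_0_iff)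
      then have "real q ^ card S0 + (real q ^ k - 1) * real q ^ Suc (card S0) \<le> (real q ^ Suc k - 1) * real q ^ card S0"
        by (simp add: algebra_simps)
      then show ?thesis unfolding \<tau>_def add_divide_distrib[symmetric] by (intro divide_right_mono) auto
    qed
    finally show False using Suc.prems(4) by simp
  qed
  then obtain d where d: "d \<in> V" "d \<notin> vs.span S0" "\<tau> < \<mu> d ^ (C ^ k)" unfolding W_def by blast
  have dS0: "d \<notin> S0" using d(2) vs.span_base by blast
  have "\<exists>S x. S \<subseteq> V \<and> vs.independent S \<and> card S = card (insert d S0) + k \<and> x \<in> V
      \<and> (\<forall>v\<in>vs.span S. x + v \<in> line_kernel A d)"
  proof (rule Suc.IH)
    show "vs.independent (insert d S0)" using Suc.prems(1) d(2) by (rule vs.independent_insertI[rotated])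
    show "insert d S0 \<subseteq> V" using Suc.prems(2) d(1) by blast
    show "(real q ^ k - 1) * real q ^ card (insert d S0) / card V < (\<kappa> * dens V (line_kernel A d)) ^ (C ^ k)"
      using d(3) finS0 dS0 by (simp add: \<tau>_def \<mu>_def)
    \<comment> \<open>Invariance is inherited: the d-component of v only shifts the parameter along
      the line, and the rest lies in the old span.\<close>
    fix x v assume x: "x \<in> line_kernel A d" and "v \<in> vs.span (insert d S0)"
    then obtain c where c: "v - vscale c d \<in> vs.span S0" using vs.span_breakdown_eq by blast
    show "x + v \<in> line_kernel A d"
      unfolding line_kernel_def
    proof (intro CollectI allI)
      fix c'
      have "x + vscale (c + c') d \<in> A" using x unfolding line_kernel_def by blast
      then have "x + vscale (c + c') d + (v - vscale c d) \<in> A" using c by (rule Suc.prems(3))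
      moreover have "x + vscale (c + c') d + (v - vscale c d) = x + v + vscale c' d"
        by (simp add: vs.scale_left_distrib)
      ultimately show "x + v + vscale c' d \<in> A" by simp
    qed
  qed
  then obtain S x where Sx: "S \<subseteq> V" "vs.independent S" "card S = card (insert d S0) + k" "x \<in> V"
    "\<forall>v\<in>vs.span S. x + v \<in> line_kernel A d" by blast
  have "line_kernel A d \<subseteq> A"
  proof
    fix y assume "y \<in> line_kernel A d"
    then have "y + vscale 0 d \<in> A" unfolding line_kernel_def by blast
    then show "y \<in> A" by simp
  qed
  then have "\<forall>v\<in>vs.span S. x + v \<in> A" using Sx(5) by blast
  moreover have "card S = card S0 + Suc k" using Sx(3) finS0 dS0 by simp
  ultimately show ?case using Sx by blast
qed

section \<open>The recursion for colourings of vectors\<close>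

text \<open>Let U be a largest subspace of V avoiding R. Adjoining any v outside U creates an
  element of R with nonzero v-component, so v is a sum of an element of R and one of U. Thus
  translates of U by 0 and by the elements of R in V cover V.\<close>

lemma card_ge_if_meets_all_subspaces:
  fixes V R :: "(nat \<Rightarrow> 'a::{field,finite}) set"
  defines "q \<equiv> card (UNIV :: 'a set)"
  assumes V: "vs.subspace V" "finite V" and t: "t \<le> vs.dim V"
    and R: "0 \<notin> R" "\<And>c v. c \<noteq> 0 \<Longrightarrow> v \<in> R \<Longrightarrow> vscale c v \<in> R"
    and meets: "\<And>U. vs.subspace U \<Longrightarrow> U \<subseteq> V \<Longrightarrow> card U = q ^ t \<Longrightarrow> U \<inter> R \<noteq> {}"
  shows "card V \<le> card (V \<inter> R) * q ^ t"
proof -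
  have q2: "2 \<le> q" unfolding q_def by (rule card_field_ge_2)
  define P where "P U \<longleftrightarrow> vs.subspace U \<and> U \<subseteq> V \<and> U \<inter> R = {}" for U
  have "P {0}" using R(1) vs.subspace_0[OF V(1)] by (simp add: P_def)
  moreover have "\<forall>U. P U \<longrightarrow> card U < Suc (card V)"
    using V(2) by (auto simp: P_def less_Suc_eq_le intro: card_mono)
  ultimately obtain U where U: "P U" "\<And>U'. P U' \<Longrightarrow> card U' \<le> card U"
    using ex_has_greatest_nat[of P "{0}" card] by blast
  have sU: "vs.subspace U" and UV: "U \<subseteq> V" and UR: "U \<inter> R = {}" using U(1) by (auto simp: P_def)
  have finU: "finite U" using UV V(2) by (rule finite_subset)
  have spU: "vs.span U = U" using sU by (simp add: vs.span_eq_iff)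
  have cU: "card U = q ^ vs.dim U" unfolding q_def using sU finU by (rule card_subspace)
  have dimU: "vs.dim U < t"
  proof (rule ccontr)
    assume "\<not> ?thesis"
    then obtain U' where "U' \<subseteq> U" "vs.subspace U'" "card U' = q ^ t"
      using exists_subspace_of_card[OF sU finU, of t] by (auto simp: q_def)
    then show False using meets[of U'] UV UR by blast
  qed
  have cover: "V \<subseteq> U \<union> (\<lambda>(w, u). w + u) ` ((V \<inter> R) \<times> U)"
  proof
    fix v assume v: "v \<in> V"
    show "v \<in> U \<union> (\<lambda>(w, u). w + u) ` ((V \<inter> R) \<times> U)"
    proof (cases "v \<in> U")
      case False
      let ?W = "vs.span (insert v U)"
      have "card ?W = q * card U" using card_span_insert(2)[of U v] False finU by (simp add: spU q_def)
      moreover have "0 < card U" using q2 by (simp add: cU)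
      ultimately have "card U < card ?W" using q2 by simp
      then have "\<not> P ?W" using U(2) by fastforce
      moreover have WV: "?W \<subseteq> V" using v UV V(1) by (intro vs.span_minimal) auto
      ultimately obtain w where w: "w \<in> ?W" "w \<in> R" by (auto simp: P_def)
      obtain c where "w - vscale c v \<in> vs.span U" using w(1) vs.span_breakdown_eq by blast
      then have c: "w - vscale c v \<in> U" by (simp add: spU)
      have "c \<noteq> 0"
      proof
        assume "c = 0"
        then have "w \<in> U" using c by simp
        then show False using w(2) UR by blast
      qed
      have "vscale (inverse c) w \<in> V \<inter> R"
        using w WV R(2)[of "inverse c" w] \<open>c \<noteq> 0\<close> vs.subspace_scale[OF V(1)] by auto
      moreover have "vscale (- inverse c) (w - vscale c v) \<in> U"
        using c by (rule vs.subspace_scale[OF sU])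
      moreover have "v = vscale (inverse c) w + vscale (- inverse c) (w - vscale c v)"
        using \<open>c \<noteq> 0\<close> by (simp add: vs.scale_right_diff_distrib)
      ultimately show ?thesis by (intro UnI2 image_eqI[where x = "(vscale (inverse c) w, vscale (- inverse c) (w - vscale c v))"]) auto
    qed simp
  qed
  have "card V \<le> card (U \<union> (\<lambda>(w, u). w + u) ` ((V \<inter> R) \<times> U))"
    using V(2) finU by (intro card_mono cover) auto
  also have "\<dots> \<le> card U + card ((\<lambda>(w, u). w + u) ` ((V \<inter> R) \<times> U))" by (rule card_Un_le)
  also have "card ((\<lambda>(w, u). w + u) ` ((V \<inter> R) \<times> U)) \<le> card (V \<inter> R) * card U"
    using V(2) finU card_image_le[of "(V \<inter> R) \<times> U" "\<lambda>(w, u). w + u"] by (simp add: card_cartesian_product)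
  finally have le: "card V \<le> (1 + card (V \<inter> R)) * card U" by simp
  have "card (V \<inter> R) \<noteq> 0"
  proof
    assume "card (V \<inter> R) = 0"
    then have "q ^ vs.dim V \<le> q ^ vs.dim U" using le cU card_subspace[OF V] by (simp add: q_def)
    then have "vs.dim V \<le> vs.dim U" using q2 by (subst (asm) power_increasing_iff) auto
    then show False using dimU t by simp
  qed
  \<comment> \<open>The translate U itself is absorbed by the spare factor q, available because dim
    U < t.\<close>
  then have "1 + card (V \<inter> R) \<le> card (V \<inter> R) * q"
    using mult_le_mono2[OF q2, of "card (V \<inter> R)"] by linarith
  then have "(1 + card (V \<inter> R)) * card U \<le> card (V \<inter> R) * q * card U" by (rule mult_le_mono1)
  also have "\<dots> = card (V \<inter> R) * q ^ Suc (vs.dim U)" by (simp add: cU)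
  also have "\<dots> \<le> card (V \<inter> R) * q ^ t"
    using dimU q2 by (intro mult_le_mono2 power_increasing) auto
  finally show ?thesis using le by simp
qed

text \<open>A colouring of lines becomes a set R of nonzero vectors closed under nonzero scaling.
  Quantifying over every finite V of dimension n lets the induction hypothesis be applied inside a
  subspace.\<close>

definition vec_ramsey :: "'a::{field,finite} itself \<Rightarrow> nat \<Rightarrow> nat \<Rightarrow> nat \<Rightarrow> bool" where
  "vec_ramsey _ n s t \<longleftrightarrow>
     (\<forall>V R :: (nat \<Rightarrow> 'a) set. vs.subspace V \<and> finite V \<and> vs.dim V = n \<and> 0 \<notin> R
          \<and> (\<forall>c v. c \<noteq> 0 \<longrightarrow> v \<in> R \<longrightarrow> vscale c v \<in> R) \<longrightarrow>
        (\<exists>U\<subseteq>V. vs.subspace U \<and> vs.dim U = s \<and> U - {0} \<subseteq> R)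
      \<or> (\<exists>U\<subseteq>V. vs.subspace U \<and> vs.dim U = t \<and> U \<inter> R = {}))"

lemma vec_ramsey_1: "vec_ramsey TYPE('a::{field,finite}) t 1 t"
  unfolding vec_ramsey_def
proof (intro allI impI, elim conjE)
  fix V R :: "(nat \<Rightarrow> 'a) set"
  assume V: "vs.subspace V" "finite V" "vs.dim V = t"
    and R: "0 \<notin> R" "\<forall>c v. c \<noteq> 0 \<longrightarrow> v \<in> R \<longrightarrow> vscale c v \<in> R"
  show "(\<exists>U\<subseteq>V. vs.subspace U \<and> vs.dim U = 1 \<and> U - {0} \<subseteq> R)
      \<or> (\<exists>U\<subseteq>V. vs.subspace U \<and> vs.dim U = t \<and> U \<inter> R = {})"
  proof (cases "V \<inter> R = {}")
    case False
    then obtain v where v: "v \<in> V" "v \<in> R" by blast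
    have "vs.span {v} \<subseteq> V" using v V(1) by (intro vs.span_minimal) auto
    moreover have "vs.dim (vs.span {v}) = 1"
      using v R(1) vs.dim_span_eq_card_independent[of "{v}"] by (auto simp: vs.dependent_single)
    moreover have "vs.span {v} - {0} \<subseteq> R"
      using v(2) R(2) by (auto simp: vs.span_singleton)
    ultimately show ?thesis by (meson vs.subspace_span)
  qed (use V in blast)
qed

text \<open>The dimension is an exact fit: the normalised red density is at least
  \<open>q ^ -(t + e)\<close>, and its \<open>C ^ k\<close>-th power equals
  \<open>q ^ k / card V\<close>, just above the threshold \<open>(q ^ k - 1) / card V\<close> for k
  directions.\<close>

lemma vec_ramsey_Suc:
  fixes e C k :: nat
  defines "\<kappa> \<equiv> 1 / real (card (UNIV :: 'a::{field,finite} set)) ^ e"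
  assumes C: "1 \<le> C"
    and step: "\<And>V A :: (nat \<Rightarrow> 'a) set. vs.subspace V \<Longrightarrow> finite V \<Longrightarrow>
       (\<kappa> * dens V A) ^ C \<le> avg V (\<lambda>d. \<kappa> * dens V (line_kernel A d))"
    and IH: "vec_ramsey TYPE('a) k s t"
  shows "vec_ramsey TYPE('a) ((t + e) * C ^ k + k) (Suc s) t"
  unfolding vec_ramsey_def
proof (intro allI impI, elim conjE)
  fix V R :: "(nat \<Rightarrow> 'a) set"
  assume V: "vs.subspace V" "finite V" and dimV: "vs.dim V = (t + e) * C ^ k + k"
    and R: "0 \<notin> R" "\<forall>c v. c \<noteq> 0 \<longrightarrow> v \<in> R \<longrightarrow> vscale c v \<in> R"
  define q where "q = card (UNIV :: 'a set)"
  define n where "n = (t + e) * C ^ k + k"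
  have \<kappa>: "\<kappa> = 1 / real q ^ e" by (simp add: \<kappa>_def q_def)
  have q2: "2 \<le> q" unfolding q_def by (rule card_field_ge_2)
  have qpos: "0 < real q" using q2 by simp
  have cV: "card V = q ^ n" using card_subspace[OF V] dimV by (simp add: q_def n_def)
  have "t * 1 \<le> (t + e) * C ^ k" using C by (intro mult_le_mono) auto
  then have tn: "t \<le> n" by (simp add: n_def)
  show "(\<exists>U\<subseteq>V. vs.subspace U \<and> vs.dim U = Suc s \<and> U - {0} \<subseteq> R)
      \<or> (\<exists>U\<subseteq>V. vs.subspace U \<and> vs.dim U = t \<and> U \<inter> R = {})"
  proof (rule disjCI)
    assume no_blue: "\<not> (\<exists>U\<subseteq>V. vs.subspace U \<and> vs.dim U = t \<and> U \<inter> R = {})"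
    have "card V \<le> card (V \<inter> R) * q ^ t"
      unfolding q_def
    proof (rule card_ge_if_meets_all_subspaces[OF V])
      fix U assume U: "vs.subspace U" "U \<subseteq> V" "card U = card (UNIV :: 'a set) ^ t"
      then have "vs.dim U = t" using V(2) finite_subset by (intro subspace_dim_eqI) auto
      then show "U \<inter> R \<noteq> {}" using no_blue U by blast
    qed (use R tn dimV in \<open>auto simp: n_def\<close>)
    then have "real (card V) \<le> real (card (V \<inter> R)) * real q ^ t"
      by (metis of_nat_le_iff of_nat_mult of_nat_power)
    then have "1 / real q ^ t \<le> dens V R"
      using V(2) qpos by (simp add: dens_eq_card cV field_simps)
    then have "1 / real q ^ e * (1 / real q ^ t) \<le> \<kappa> * dens V R"
      unfolding \<kappa> by (rule mult_left_mono) simp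
    then have "(1 / real q ^ (t + e)) ^ C ^ k \<le> (\<kappa> * dens V R) ^ C ^ k"
      using qpos by (intro power_mono) (simp_all add: power_add mult.commute)
    moreover have "(1 / real q ^ (t + e)) ^ C ^ k = real q ^ k / card V"
    proof -
      have "(1 / real q ^ (t + e)) ^ C ^ k = 1 / real q ^ ((t + e) * C ^ k)"
        by (simp add: power_divide flip: power_mult)
      then show ?thesis using qpos by (simp add: cV n_def power_add)
    qed
    moreover have "(real q ^ k - 1) / card V < real q ^ k / card V"
      using qpos by (simp add: cV divide_strict_right_mono)
    ultimately have big: "(real q ^ k - 1) * real q ^ card ({} :: (nat \<Rightarrow> 'a) set) / card V < (\<kappa> * dens V R) ^ C ^ k"
      by simp
    have "\<exists>S x. S \<subseteq> V \<and> vs.independent S \<and> card S = card ({} :: (nat \<Rightarrow> 'a) set) + k \<and> x \<in> V \<and> (\<forall>v\<in>vs.span S. x + v \<in> R)"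
    proof (rule exists_affine_subspace[OF V _ _ step[OF V]])
      show "0 < \<kappa>" "\<kappa> \<le> 1" using q2 by (auto simp: \<kappa>)
    qed (use big in \<open>auto simp: q_def vs.independent_empty\<close>)
    then obtain S x where S: "S \<subseteq> V" "vs.independent S" "card S = k"
      and x: "x \<in> V" "\<And>v. v \<in> vs.span S \<Longrightarrow> x + v \<in> R" by auto
    have finS: "finite S" using S(1) V(2) by (rule finite_subset)
    have SV: "vs.span S \<subseteq> V" using S(1) V(1) by (rule vs.span_minimal)
    have "finite (vs.span S)" "vs.dim (vs.span S) = k"
      using card_span_independent(1)[OF finS S(2)] vs.dim_span_eq_card_independent[OF S(2)] S(3) by auto
    then consider U where "U \<subseteq> vs.span S" "vs.subspace U" "vs.dim U = s" "U - {0} \<subseteq> R"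
      | U where "U \<subseteq> vs.span S" "vs.subspace U" "vs.dim U = t" "U \<inter> R = {}"
      using IH R unfolding vec_ramsey_def by (metis vs.subspace_span)
    then show "\<exists>U\<subseteq>V. vs.subspace U \<and> vs.dim U = Suc s \<and> U - {0} \<subseteq> R"
    proof cases
      case (1 U)
      \<comment> \<open>Otherwise the red translate x + span S would contain 0.\<close>
      have xU: "x \<notin> U"
      proof
        assume "x \<in> U"
        then have "- x \<in> vs.span S" using 1 vs.span_neg by blast
        then have "x + - x \<in> R" by (rule x(2))
        then show False using R(1) by (simp only: add.right_inverse)
      qed
      have "U \<subseteq> V" using 1(1) SV by blast
      then have finU: "finite U" using V(2) by (rule finite_subset)
      have spU: "vs.span U = U" using 1(2) by (simp add: vs.span_eq_iff)
      let ?W = "vs.span (insert x U)"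
      have "card ?W = q ^ Suc s"
        using card_span_insert(2)[of U x] xU finU card_subspace[OF 1(2) finU] 1(3) by (simp add: spU q_def)
      moreover have "finite ?W" using card_span_insert(1)[of U x] xU finU by (simp add: spU)
      ultimately have "vs.dim ?W = Suc s"
        unfolding q_def by (intro subspace_dim_eqI vs.subspace_span)
      moreover have "?W \<subseteq> V" using x(1) 1(1) SV V(1) by (intro vs.span_minimal) auto
      moreover have "?W - {0} \<subseteq> R"
      proof
        fix w assume w: "w \<in> ?W - {0}"
        then obtain c where "w - vscale c x \<in> vs.span U" using vs.span_breakdown_eq by blast
        then have c: "w - vscale c x \<in> U" by (simp add: spU)
        show "w \<in> R"
        \<comment> \<open>For nonzero c, w is c times a point of the red translate x + span S; for c
          = 0 it lies in the red subspace U.\<close>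
        proof (cases "c = 0")
          case True
          then show ?thesis using c w 1(4) by auto
        next
          case False
          have "vscale (inverse c) (w - vscale c x) \<in> vs.span S"
            using c 1(1) vs.span_scale by blast
          then have "vscale c (x + vscale (inverse c) (w - vscale c x)) \<in> R"
            using x(2) R(2) False by blast
          then show ?thesis using False by (simp add: vs.scale_right_distrib)
        qed
      qed
      ultimately show ?thesis by (meson vs.subspace_span)
    next
      case (2 U)
      then show ?thesis using no_blue SV by blast
    qed
  qed
qed

text \<open>Colour a nonzero vector like the line it spans. Conversely a line is spanned by any of
  its nonzero vectors, so the colour of a subspace passes back to its lines.\<close>

lemma ramsey_prop_if_vec_ramsey:
  assumes "vec_ramsey TYPE('a::{field,finite}) n s t"
  shows "ramsey_prop TYPE('a) n s t"
  unfolding ramsey_prop_def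
proof
  fix col :: "(nat \<Rightarrow> 'a) set \<Rightarrow> bool"
  define R where "R = {v. v \<noteq> 0 \<and> col (vs.span {v})}"
  have "vs.span {vscale c v} = vs.span {v}" if "c \<noteq> 0" for c and v :: "nat \<Rightarrow> 'a"
  proof (rule antisym)
    show "vs.span {vscale c v} \<subseteq> vs.span {v}"
      by (intro vs.span_minimal) (auto intro: vs.span_scale vs.span_base)
    have "v = vscale (inverse c) (vscale c v)" using that by simp
    then have "v \<in> vs.span {vscale c v}" using vs.span_base[of "vscale c v"] vs.span_scale by (metis singletonI)
    then show "vs.span {v} \<subseteq> vs.span {vscale c v}" by (intro vs.span_minimal) auto
  qed
  then have R: "0 \<notin> R" "\<forall>c v. c \<noteq> 0 \<longrightarrow> v \<in> R \<longrightarrow> vscale c v \<in> R"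
    by (auto simp: R_def)
  have "vs.dim (Fn n :: (nat \<Rightarrow> 'a) set) = n"
    by (intro subspace_dim_eqI subspace_Fn card_Fn)
  then have cases: "(\<exists>U\<subseteq>Fn n. vs.subspace U \<and> vs.dim U = s \<and> U - {0} \<subseteq> R)
      \<or> (\<exists>U\<subseteq>Fn n. vs.subspace U \<and> vs.dim U = t \<and> U \<inter> R = {})"
    using assms R card_Fn(1)[of n, where 'a = 'a] subspace_Fn[of n, where 'a = 'a]
    unfolding vec_ramsey_def by blast
  have line: "\<exists>v\<in>L. v \<noteq> 0 \<and> L = vs.span {v}" if "L \<in> lin_subspaces TYPE('a) n 1" for L
  proof -
    have L: "L \<subseteq> Fn n" "vs.subspace L" "vs.dim L = 1" using that by (auto simp: lin_subspaces_def)
    have finL: "finite L" using L(1) card_Fn(1) by (rule finite_subset)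
    have cL: "card L = card (UNIV :: 'a set)" using card_subspace[OF L(2) finL] L(3) by simp
    have "\<not> L \<subseteq> {0}"
      using card_mono[of "{0}" L] cL card_field_ge_2[where 'a = 'a] by auto
    then obtain v where v: "v \<in> L" "v \<noteq> 0" by blast
    have "card (vs.span {v}) = card L"
      using card_span_independent(2)[of "{v}"] v(2) cL by (simp add: vs.dependent_single)
    moreover have "vs.span {v} \<subseteq> L" using v(1) L(2) by (intro vs.span_minimal) auto
    ultimately have "vs.span {v} = L" using finL by (intro card_subset_eq)
    then show ?thesis using v by blast
  qed
  from cases show "(\<exists>W\<in>lin_subspaces TYPE('a) n s. \<forall>L\<in>lin_subspaces TYPE('a) n 1. L \<subseteq> W \<longrightarrow> col L)
      \<or> (\<exists>W\<in>lin_subspaces TYPE('a) n t. \<forall>L\<in>lin_subspaces TYPE('a) n 1. L \<subseteq> W \<longrightarrow> \<not> col L)"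
  proof (elim disjE exE conjE)
    fix U assume U: "U \<subseteq> Fn n" "vs.subspace U" "vs.dim U = s" "U - {0} \<subseteq> R"
    have "\<forall>L\<in>lin_subspaces TYPE('a) n 1. L \<subseteq> U \<longrightarrow> col L"
    proof (intro ballI impI)
      fix L assume "L \<in> lin_subspaces TYPE('a) n 1" "L \<subseteq> U"
      then show "col L" using line[of L] U(4) unfolding R_def by blast
    qed
    moreover have "U \<in> lin_subspaces TYPE('a) n s" using U by (simp add: lin_subspaces_def)
    ultimately show ?thesis by blast
  next
    fix U assume U: "U \<subseteq> Fn n" "vs.subspace U" "vs.dim U = t" "U \<inter> R = {}"
    have "\<forall>L\<in>lin_subspaces TYPE('a) n 1. L \<subseteq> U \<longrightarrow> \<not> col L"
    proof (intro ballI impI)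
      fix L assume "L \<in> lin_subspaces TYPE('a) n 1" "L \<subseteq> U"
      then show "\<not> col L" using line[of L] U(4) unfolding R_def by blast
    qed
    moreover have "U \<in> lin_subspaces TYPE('a) n t" using U by (simp add: lin_subspaces_def)
    ultimately show ?thesis by blast
  qed
qed

text \<open>The last argument is shifted by one: \<open>ramsey_bound C e t s\<close> is the dimension for a red subspace
  of dimension \<open>Suc s\<close>.\<close>

primrec ramsey_bound :: "nat \<Rightarrow> nat \<Rightarrow> nat \<Rightarrow> nat \<Rightarrow> nat" where
  "ramsey_bound C e t 0 = t"
| "ramsey_bound C e t (Suc s) = (t + e) * C ^ ramsey_bound C e t s + ramsey_bound C e t s"

lemma vec_ramsey_bound_2:
  assumes "card (UNIV :: 'a::{field,finite} set) = 2"
  shows "vec_ramsey TYPE('a) (ramsey_bound 2 0 t s) (Suc s) t"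
proof (induction s)
  case (Suc s)
  then show ?case
    using vec_ramsey_Suc[where 'a = 'a and C = 2 and e = 0 and s = "Suc s"] by (simp add: avg_dens_line_kernel_2[OF assms])
qed (use vec_ramsey_1 in simp)

text \<open>e = 3 because the densities are normalised by 27 = 3 * 3 * 3.\<close>

lemma vec_ramsey_bound_3:
  assumes "card (UNIV :: 'a::{field,finite} set) = 3"
  shows "vec_ramsey TYPE('a) (ramsey_bound 16 3 t s) (Suc s) t"
proof (induction s)
  case (Suc s)
  then show ?case
    using vec_ramsey_Suc[where 'a = 'a and C = 16 and e = 3 and s = "Suc s"] avg_dens_line_kernel_3[OF assms]
    by (simp add: assms)
qed (use vec_ramsey_1 in simp)

section \<open>Tower estimates\<close>

text \<open>The lower bound is chosen so that log 3 of \<open>gamma0\<close> is at least 6/7, which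
  makes \<open>C0\<close> at least 8; the upper bound keeps the denominator in \<open>C0\<close>
  positive.\<close>

lemma gamma0_bounds: "3 powr (6/7) \<le> gamma0" "gamma0 < 3"
proof -
  let ?f = "\<lambda>x::real. (1 + x + x\<^sup>2) / x powr (2/3)"
  have low: "3 powr (6/7) \<le> ?f x" if x: "x \<in> {0<..<1}" for x
  proof -
    have x0: "0 < x" "x < 1" using x by auto
    have cube: "(x powr (2/3)) ^ 3 = x\<^sup>2"
      using x0 by (simp add: powr_power)
    have "17 * x\<^sup>2 \<le> (1 + x + x\<^sup>2) ^ 3"
    proof -
      \<comment> \<open>A minorant on (0,1) of the difference of the two sides. Its double root 5/8
        is close to the minimiser (sqrt 33 - 1)/8 of \<open>?f\<close>.\<close>
      have "0 \<le> (1 - 8/5 * x)\<^sup>2 * (1 + 31/5 * x + 2 * x\<^sup>2)"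
        using x0 by (intro mult_nonneg_nonneg) auto
      also have "\<dots> = 1 + 3 * x - 382/25 * x^2 + 1184/125 * x^3 + 128/25 * x^4"
        by (simp add: eval_nat_numeral algebra_simps)
      finally have "0 \<le> \<dots>" .
      moreover have "x ^ 3 \<le> x ^ 2" using x0 by (intro power_decreasing) auto
      moreover have "0 \<le> x ^ 4" "0 \<le> x ^ 5" "0 \<le> x ^ 6" using x0 by auto
      moreover have "(1 + x + x\<^sup>2) ^ 3 = 1 + 3 * x + 6 * x^2 + 7 * x^3 + 6 * x^4 + 3 * x^5 + x^6"
        by (simp add: eval_nat_numeral algebra_simps)
      moreover have "0 \<le> x ^ 2" by simp
      ultimately show ?thesis by linarith
    qed
    then have "17 \<le> ?f x ^ 3"
      using x0 by (simp add: power_divide cube field_simps)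
    \<comment> \<open>\<open>17 ^ 7 >= 3 ^ 18\<close>, which is the comparison of 17 powr (1/3) with
      3 powr (6/7).\<close>
    then have "17 ^ 7 \<le> (?f x ^ 3) ^ 7" by (rule power_mono) simp
    moreover have "(3 powr (6/7)) ^ 21 = (3::real) ^ 18"
      by (simp add: powr_power)
    ultimately have "(3 powr (6/7)) ^ Suc 20 \<le> ?f x ^ Suc 20"
      by (simp flip: power_mult)
    then show ?thesis by (rule power_le_imp_le_base) (use x0 in simp)
  qed
  show "3 powr (6/7) \<le> gamma0"
    unfolding gamma0_def using low by (intro cInf_greatest) (auto intro: exI[of _ "1/2"])
  \<comment> \<open>The test point is the cube of 3/4, which makes its power 2/3 rational.\<close>
  have "(27/64 :: real) powr (2/3) = 9/16"
  proof -
    have "(27/64 :: real) = (3/4) powr 3" by (simp add: power3_eq_cube)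
    then have "(27/64 :: real) powr (2/3) = (3/4) powr 2" by (simp only: powr_powr) simp
    then show ?thesis by (simp add: power2_eq_square)
  qed
  then have "?f (27/64) < 3" by (simp only:) (simp add: power2_eq_square)
  moreover have "gamma0 \<le> ?f (27/64)"
    unfolding gamma0_def
  proof (rule cInf_lower)
    show "bdd_below (?f ` {0<..<1})" using low by (intro bdd_belowI2[of _ "3 powr (6/7)"])
    show "?f (27/64) \<in> ?f ` {0<..<1}" by (rule imageI) simp
  qed
  ultimately show "gamma0 < 3" by simp
qed

lemma C0_ge_8: "8 \<le> C0"
proof -
  have g: "0 < gamma0" using gamma0_bounds(1) by (rule less_le_trans[rotated]) simp
  have "log 3 (3 powr (6/7)) \<le> log 3 gamma0"
    using gamma0_bounds(1) g by (subst log_le_cancel_iff) auto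
  then have lo: "6/7 \<le> log 3 gamma0" by simp
  have "log 3 gamma0 < log 3 3"
    using gamma0_bounds(2) g by (subst log_less_cancel_iff) auto
  then have hi: "log 3 gamma0 < 1" by simp
  have "7 \<le> 1 / (1 - log 3 gamma0)" using lo hi by (simp add: field_simps)
  then show ?thesis unfolding C0_def by simp
qed

text \<open>The added t makes the induction close, and it is where the top 2t of the tower comes
  from: the base case is t + t = 2t.\<close>

lemma ramsey_bound_2_le_tower:
  assumes "2 \<le> t"
  shows "real (ramsey_bound 2 0 t s + t) \<le> tower 2 (Suc s) (2 * real t)"
proof (induction s)
  case (Suc s)
  define N where "N = ramsey_bound 2 0 t s"
  have "t * 2 ^ N + N + t \<le> 2 ^ N * 2 ^ t"
  proof -
    have "2 * t \<le> 2 ^ t" using assms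
    proof (induction t rule: dec_induct)
      case (step t)
      then show ?case by simp
    qed simp
    \<comment> \<open>Half of the left side covers \<open>t * 2 ^ N\<close>; the other half covers N
      + t.\<close>
    then have "2 ^ N * (2 * t) \<le> 2 ^ N * 2 ^ t" by (rule mult_le_mono2)
    moreover have "t * Suc N \<le> t * 2 ^ N" using less_exp[of N] by (intro mult_le_mono2 Suc_leI)
    moreover have "1 * N \<le> t * N" using assms by (intro mult_le_mono1) simp
    moreover have "2 ^ N * (2 * t) = 2 * (t * 2 ^ N)" by (simp only: mult_ac)
    moreover have "t * Suc N = t + t * N" by simp
    ultimately show ?thesis by linarith
  qed
  then have "real (ramsey_bound 2 0 t (Suc s) + t) \<le> real (2 ^ (N + t))"
    by (intro of_nat_mono) (simp add: N_def power_add)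
  also have "\<dots> = 2 powr real (N + t)" by (subst powr_realpow) simp_all
  also have "\<dots> \<le> 2 powr tower 2 (Suc s) (2 * real t)"
    using Suc by (intro powr_mono) (auto simp: N_def)
  finally show ?case by simp
qed simp

text \<open>The factor 4/3 is the logarithm of 16 to base 8: multiplied out,
  \<open>2 powr (4 * N + 2 * t)\<close> is at most \<open>2 powr (3 * T)\<close> =
  \<open>8 powr T\<close>, which is at most \<open>C0 powr T\<close>.\<close>

lemma ramsey_bound_3_le_tower:
  assumes "2 \<le> t"
  shows "real (4 * ramsey_bound 16 3 t s + 2 * t) \<le> 3 * tower C0 (Suc s) (2 * real t)"
proof (induction s)
  case (Suc s)
  define N where "N = ramsey_bound 16 3 t s"
  let ?T = "tower C0 (Suc s) (2 * real t)"
  have "4 * ((t + 3) * 16 ^ N + N) + 2 * t \<le> 3 * (16 ^ N * 4 ^ t)"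
  proof -
    have "8 * t \<le> 4 ^ t" using assms
    proof (induction t rule: dec_induct)
      case (step t)
      then show ?case by simp
    qed simp
    then have le: "16 ^ N * (8 * t) \<le> 16 ^ N * 4 ^ t" by (rule mult_le_mono2)
    have "N \<le> 16 ^ N" using less_exp[of N] power_mono[of "2::nat" 16 N] by simp
    moreover have "2 * 16 ^ N \<le> t * 16 ^ N" using assms by (intro mult_le_mono1)
    moreover have "t * 1 \<le> t * 16 ^ N" by (intro mult_le_mono2) simp
    ultimately have sum_le: "4 * (t * 16 ^ N) + 12 * 16 ^ N + 4 * N + 2 * t \<le> 24 * (t * 16 ^ N)" by linarith
    have "4 * ((t + 3) * 16 ^ N + N) + 2 * t = 4 * (t * 16 ^ N) + 12 * 16 ^ N + 4 * N + 2 * t"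
      by (simp only: distrib_left distrib_right)
    also note sum_le
    also have "24 * (t * 16 ^ N) = 3 * (16 ^ N * (8 * t))" by simp
    also have "\<dots> \<le> 3 * (16 ^ N * 4 ^ t)" using le by (rule mult_le_mono2)
    finally show ?thesis .
  qed
  then have "real (4 * ramsey_bound 16 3 t (Suc s) + 2 * t) \<le> real (3 * 2 ^ (4 * N + 2 * t))"
    by (intro of_nat_mono) (simp add: N_def power_add power_mult)
  also have "\<dots> = 3 * 2 powr real (4 * N + 2 * t)" by (subst powr_realpow) simp_all
  also have "\<dots> \<le> 3 * 2 powr (3 * ?T)"
    using Suc by (intro mult_left_mono powr_mono) (auto simp: N_def)
  also have "2 powr (3 * ?T) = 8 powr ?T"
    unfolding powr_powr[symmetric] by simp
  also have "3 * 8 powr ?T \<le> 3 * C0 powr ?T"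
  proof (rule mult_left_mono, rule powr_mono2)
    have "0 \<le> 3 * ?T" using Suc by (rule order_trans[rotated]) simp
    then show "0 \<le> ?T" by simp
  qed (use C0_ge_8 in auto)
  finally show ?case by simp
qed simp

lemma ramsey_num_le:
  assumes "ramsey_prop TYPE('a::field) n s t"
  shows "ramsey_num TYPE('a) s t \<le> n"
  unfolding ramsey_num_def using assms by (rule Least_le)

text \<open>The existence clause ensures that the \<open>LEAST\<close> in \<open>ramsey_num\<close>
  is taken over a nonempty set.\<close>

theorem theorem5p1:
  fixes s t :: nat
  assumes "card (UNIV :: 'a::{field,finite} set) = 2 \<or> card (UNIV :: 'a set) = 3"
    and "2 \<le> s" and "s \<le> t"
  shows "(\<exists>n. ramsey_prop TYPE('a) n s t) \<and>
         real (ramsey_num TYPE('a) s t)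
           \<le> tower (if card (UNIV :: 'a set) = 2 then 2 else C0) s (2 * real t)"
proof -
  obtain r where r: "s = Suc r" using assms(2) by (cases s) auto
  have t: "2 \<le> t" using assms by linarith
  from assms(1) show ?thesis
  proof
    assume q: "card (UNIV :: 'a set) = 2"
    have "ramsey_prop TYPE('a) (ramsey_bound 2 0 t r) s t"
      unfolding r using vec_ramsey_bound_2[OF q] by (rule ramsey_prop_if_vec_ramsey)
    moreover from this have "ramsey_num TYPE('a) s t \<le> ramsey_bound 2 0 t r + t"
      using ramsey_num_le by fastforce
    then have "real (ramsey_num TYPE('a) s t) \<le> tower 2 s (2 * real t)"
      unfolding r using ramsey_bound_2_le_tower[OF t, of r] by linarith
    ultimately show ?thesis using q by auto
  next
    assume q: "card (UNIV :: 'a set) = 3"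
    have "ramsey_prop TYPE('a) (ramsey_bound 16 3 t r) s t"
      unfolding r using vec_ramsey_bound_3[OF q] by (rule ramsey_prop_if_vec_ramsey)
    moreover from this have "ramsey_num TYPE('a) s t \<le> ramsey_bound 16 3 t r"
      by (rule ramsey_num_le)
    then have "real (ramsey_num TYPE('a) s t) \<le> tower C0 s (2 * real t)"
      unfolding r using ramsey_bound_3_le_tower[OF t, of r] by simp
    ultimately show ?thesis using q by auto
  qed
qed

end
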